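(* One has $$\liminf_{t\to\infty}\frac{\left|\{\,n\in\mathbb{Z}^+ : n\le t,\ E_n^{(n)}(x)\text{ is in Eisenstein form}\,\}\right|}{t}\ \ge\ \frac{\log 2}{2}=0.34657\ldots,$$ where $\log$ is the natural logarithm. In particular, asymptotically more than one-third of the polynomials $E_n^{(n)}(x)$ are irreducible over $\mathbb{Q}$ (and in fact Eisenstein), i.e. the lower density of the set of such positive integers $n$ is greater than $1/3$.
   Context: For a positive integer $m$ and an integer $n\ge 0$, the $m$th order Euler polynomial of degree $n$, denoted $E_n^{(m)}(x)\in\mathbb{Q}[x]$, is defined by the identity of formal power series in $t$ $$\left(\frac{2}{e^t+1}\right)^m e^{tx}=\sum_{n=0}^{\infty}E_n^{(m)}(x)\frac{t^n}{n!}.$$ Thus $E_n^{(n)}(x)$ is the case $m=n$. For a prime $p$, $\nu_p$ denotes the $p$-adic valuation on $\mathbb{Q}$ (with $\nu_p(0)=+\infty$). A polynomial $f(x)=\sum_{j=0}^n a_jx^j\in\mathbb{Q}[x]$ of degree $n\geq 1$ is in Eisenstein form with respect to $p$ if $\nu_p(a_n)=0$, $\nu_p(a_j)\ge 1$ for all $j\in\{0,1,\ldots,n-1\}$, and $\nu_p(a_0)=1$. The polynomial $f(x)$ is in Eisenstein form if it is in Eisenstein form with respect to some prime $p$. The polynomial $f(x)$ is Eisenstein if there is an integer $a$ such that $f(x+a)$ is in Eisenstein form. *)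

theory Defs
  imports
    "HOL-Analysis.Analysis"
    "HOL-Computational_Algebra.Computational_Algebra"
begin

(* Coefficientwise embedding of Q[[t]] into Q[x][[t]]. *)
definition fps_to_poly_fps :: "rat fps \<Rightarrow> rat poly fps" where
  "fps_to_poly_fps f = Abs_fps (\<lambda>n. [:fps_nth f n:])"

(* exp(t x) in Q[x][[t]]; note that fps_exp is only useful over a field. *)
definition exp_tx :: "rat poly fps" where
  "exp_tx = Abs_fps (\<lambda>n. monom (1 / fact n) n)"

(* The power series quotient is taken in Q[[t]], where exp(t) + 1 is a unit
   (constant term 2); over the polynomial ring there is no inverse operation. *)
definition euler_gen_fun :: "nat \<Rightarrow> rat poly fps" where
  "euler_gen_fun m = fps_to_poly_fps ((2 / (fps_exp 1 + 1)) ^ m) * exp_tx"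

(* The m-th order Euler polynomial of degree n. *)
definition euler_poly :: "nat \<Rightarrow> nat \<Rightarrow> rat poly" where
  "euler_poly m n = smult (fact n) (fps_nth (euler_gen_fun m) n)"

lemma two_div_exp_plus_one: "2 / (fps_exp 1 + 1) * (fps_exp 1 + 1) = (2 :: rat fps)"
proof -
  have "fps_nth (fps_exp 1 + 1 :: rat fps) 0 \<noteq> 0"
    by simp
  hence "is_unit (fps_exp 1 + 1 :: rat fps)"
    by (rule fps_is_unit_iff[THEN iffD2])
  hence "(fps_exp 1 + 1 :: rat fps) dvd 2"
    by (rule unit_imp_dvd)
  thus ?thesis
    by (rule dvd_div_mult_self)
qed

lemma euler_poly_gen_fun:
  "fps_to_poly_fps ((2 / (fps_exp 1 + 1)) ^ m) * exp_tx
     = Abs_fps (\<lambda>n. smult (1 / fact n) (euler_poly m n))"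
  by (simp add: fps_eq_iff euler_poly_def euler_gen_fun_def)

definition padic_val :: "nat \<Rightarrow> rat \<Rightarrow> ereal" where
  "padic_val p q =
     (if q = 0 then \<infinity>
      else case quotient_of q of (a, b) \<Rightarrow>
        ereal (real (multiplicity (int p) a) - real (multiplicity (int p) b)))"

definition eisenstein_form_wrt :: "nat \<Rightarrow> rat poly \<Rightarrow> bool" where
  "eisenstein_form_wrt p f \<longleftrightarrow>
     degree f \<ge> 1 \<and>
     padic_val p (coeff f (degree f)) = 0 \<and>
     (\<forall>j<degree f. padic_val p (coeff f j) \<ge> 1) \<and>
     padic_val p (coeff f 0) = 1"

definition eisenstein_form :: "rat poly \<Rightarrow> bool" where
  "eisenstein_form f \<longleftrightarrow> (\<exists>p. prime p \<and> eisenstein_form_wrt p f)"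

definition eisenstein :: "rat poly \<Rightarrow> bool" where
  "eisenstein f \<longleftrightarrow> (\<exists>a::int. eisenstein_form (pcompose f [:of_int a, 1:]))"

(* Lower natural density of a set of positive integers; t ranges over the reals
   and the element 0, if present, is ignored. *)
definition lower_density :: "nat set \<Rightarrow> ereal" where
  "lower_density A =
     Liminf at_top (\<lambda>t::real. ereal (real (card {n\<in>A. 1 \<le> n \<and> real n \<le> t}) / t))"

end

theory Submission
  imports Defs "HOL-Number_Theory.Cong" "HOL-Real_Asymp.Real_Asymp"
begin

text \<open>
  Write \<open>f = 2 / (exp t + 1)\<close>. The \<open>j\<close>-th coefficient of the \<open>n\<close>-th order Euler polynomial of
  degree \<open>n\<close> is \<open>n choose j\<close> times the \<open>(n - j)\<close>-th derivative of \<open>f ^ n\<close> at 0. From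
  \<open>2 f' = f\<^sup>2 - 2 f\<close> one gets \<open>2 (f ^ n)' = n f ^ n (f - 2)\<close>. Up to powers of 2, all non-leading
  coefficients of the polynomial are therefore divisible by \<open>n\<close>, and substituting \<open>f ^ n = 1\<close>
  modulo \<open>n\<close> on the right shows that the constant coefficient is \<open>n (e (n - 1) + n z) / 2 ^ n\<close>
  with integers \<open>z\<close> and \<open>e k = 2 ^ k E\<^sub>k(0)\<close>. So the polynomial is in
  Eisenstein form with respect to an odd prime \<open>p\<close> that divides \<open>n\<close> exactly once and does not divide \<open>e (n - 1)\<close> (\<open>eisenstein_form_euler_poly\<close>).

  Let \<open>n = p a\<close> with \<open>a\<close> even and \<open>p > a\<close>. Modulo \<open>p\<close> the numbers \<open>e k\<close> with \<open>k > 0\<close> have period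
  \<open>p - 1\<close> (\<open>euler_num_kummer\<close>), so the condition becomes that \<open>p\<close> does not divide \<open>e (a - 1)\<close>.
  This is up to sign a tangent number: it is nonzero because \<open>a - 1\<close> is odd, and at most a
  factorial, so for each \<open>a\<close> at most \<open>a\<close> primes \<open>p > a\<close> are bad (\<open>card_primes_gt_dvd_euler_num\<close>).

  Hence almost every even \<open>n \<le> t\<close> with a prime factor \<open>p > sqrt t\<close> qualifies, and there are about
  \<open>t / 2\<close> times the sum of \<open>1 / p\<close> over \<open>sqrt t < p \<le> t\<close> of them (\<open>card_eisenstein_ge\<close>). By
  Mertens that sum tends to \<open>ln 2\<close>. The lower bound follows from the estimate
  \<open>ln x + O(1)\<close> for the sum of \<open>ln p / p\<close> over \<open>p \<le> x\<close> by cutting the range of primes into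
  intervals with geometric exponents (\<open>sum_inverse_primes_geometric\<close>).

  Irreducibility is Eisenstein's criterion (\<open>eisenstein_form_imp_irreducible\<close>), proved by a Newton
  polygon argument, and \<open>ln 2 / 2\<close> exceeds \<open>1 / 3\<close>.
\<close>

section \<open>Weighted coefficients of power series\<close>

text \<open>
  The factor \<open>fact k\<close> turns Cauchy products into binomial convolutions; the factor \<open>2 ^ k\<close>
  absorbs the powers of 2 in the denominators of the Euler numbers. In these coordinates the
  series below are integral, so that congruences modulo an odd prime are congruences of integers.
\<close>
definition hcoeff :: "rat fps \<Rightarrow> nat \<Rightarrow> rat" where
  "hcoeff F k = 2 ^ k * fact k * fps_nth F k"

definition hurwitz :: "rat fps \<Rightarrow> bool" where
  "hurwitz F \<longleftrightarrow> (\<forall>k. hcoeff F k \<in> \<int>)"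

lemma hcoeff_add: "hcoeff (F + G) k = hcoeff F k + hcoeff G k"
  by (simp add: hcoeff_def algebra_simps)

lemma hcoeff_diff: "hcoeff (F - G) k = hcoeff F k - hcoeff G k"
  by (simp add: hcoeff_def algebra_simps)

lemma hcoeff_const_mult: "hcoeff (fps_const c * F) k = c * hcoeff F k"
  by (simp add: hcoeff_def algebra_simps)

lemma hcoeff_sum: "hcoeff (sum F A) k = (\<Sum>i\<in>A. hcoeff (F i) k)"
  by (simp add: hcoeff_def fps_sum_nth sum_distrib_left)

lemma hcoeff_mult:
  "hcoeff (F * G) k = (\<Sum>i\<le>k. of_nat (k choose i) * hcoeff F i * hcoeff G (k - i))"
proof -
  have "hcoeff (F * G) k = (\<Sum>i=0..k. 2 ^ k * fact k * (fps_nth F i * fps_nth G (k - i)))"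
    unfolding hcoeff_def fps_mult_nth by (simp add: sum_distrib_left)
  also have "\<dots> = (\<Sum>i=0..k. of_nat (k choose i) * hcoeff F i * hcoeff G (k - i))"
  proof (rule sum.cong)
    fix i assume "i \<in> {0..k}"
    hence i: "i \<le> k" by simp
    have "(2::rat) ^ k = 2 ^ i * 2 ^ (k - i)"
      using i by (simp flip: power_add)
    thus "2 ^ k * fact k * (fps_nth F i * fps_nth G (k - i)) =
          of_nat (k choose i) * hcoeff F i * hcoeff G (k - i)"
      by (simp add: hcoeff_def binomial_fact[OF i] field_simps)
  qed auto
  finally show ?thesis by (simp add: atMost_atLeast0)
qed

text \<open>
  In these coordinates the derivation that shifts the coefficients is \<open>2 d/dt\<close>.
\<close>
lemma hcoeff_Suc: "hcoeff F (Suc k) = hcoeff (fps_const 2 * fps_deriv F) k"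
  by (simp add: hcoeff_def algebra_simps)

lemma hurwitz_diff: "hurwitz F \<Longrightarrow> hurwitz G \<Longrightarrow> hurwitz (F - G)"
  by (simp add: hurwitz_def hcoeff_diff)

lemma hurwitz_const: "c \<in> \<int> \<Longrightarrow> hurwitz (fps_const c)"
  by (auto simp: hurwitz_def hcoeff_def)

lemma hurwitz_mult: "hurwitz F \<Longrightarrow> hurwitz G \<Longrightarrow> hurwitz (F * G)"
  by (auto simp: hurwitz_def hcoeff_mult intro!: Ints_sum Ints_mult)

lemma hurwitz_power: "hurwitz F \<Longrightarrow> hurwitz (F ^ n)"
  using hurwitz_const[of 1] by (induction n) (auto intro: hurwitz_mult)

section \<open>The generating function and its powers\<close>

definition euler_fps :: "rat fps" where
  "euler_fps = 2 / (fps_exp 1 + 1)"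

lemma euler_fps_mult: "euler_fps * (fps_exp 1 + 1) = 2"
  unfolding euler_fps_def by (rule two_div_exp_plus_one)

lemma euler_fps_0 [simp]: "fps_nth euler_fps 0 = 1"
proof -
  have "fps_nth (euler_fps * (fps_exp 1 + 1)) 0 = 2"
    by (simp add: euler_fps_mult)
  thus ?thesis by (simp add: fps_mult_nth_0)
qed

text \<open>
  This differential equation is what makes everything recursive: it expresses the coefficients by
  earlier ones without division, and it turns the derivative of a power \<open>euler_fps ^ n\<close> into
  \<open>n\<close> times an integral series.
\<close>
lemma euler_fps_deriv:
  "fps_const 2 * fps_deriv euler_fps = euler_fps * (euler_fps - 2)"
proof -
  \<comment> \<open>Multiplying the derivative of the defining equation by \<open>euler_fps\<close> eliminates the exponential.\<close>
  have A: "euler_fps * fps_exp 1 = 2 - euler_fps"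
    using euler_fps_mult by (simp add: algebra_simps)
  have "fps_deriv (euler_fps * (fps_exp 1 + 1)) = 0"
    unfolding euler_fps_mult by (simp add: fps_numeral_fps_const)
  hence "fps_deriv euler_fps * (fps_exp 1 + 1) + euler_fps * fps_exp 1 = 0"
    by (simp add: algebra_simps)
  hence "euler_fps * (fps_deriv euler_fps * (fps_exp 1 + 1) + euler_fps * fps_exp 1) = 0"
    by simp
  hence "fps_deriv euler_fps * (euler_fps * (fps_exp 1 + 1))
           + euler_fps * (euler_fps * fps_exp 1) = 0"
    by (simp add: algebra_simps)
  hence "fps_deriv euler_fps * 2 + euler_fps * (2 - euler_fps) = 0"
    unfolding euler_fps_mult A .
  hence "2 * fps_deriv euler_fps = euler_fps * (euler_fps - 2)"
    by (simp add: algebra_simps)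
  thus ?thesis by (simp add: fps_numeral_fps_const)
qed

lemma hcoeff_euler_fps_Suc:
  "hcoeff euler_fps (Suc k) =
     (\<Sum>i\<le>k. of_nat (k choose i) * hcoeff euler_fps i * hcoeff euler_fps (k - i))
       - 2 * hcoeff euler_fps k"
proof -
  have "euler_fps * (euler_fps - 2) = euler_fps * euler_fps - fps_const 2 * euler_fps"
    by (simp add: algebra_simps fps_numeral_fps_const)
  thus ?thesis
    by (simp only: hcoeff_Suc euler_fps_deriv hcoeff_diff hcoeff_const_mult)
       (simp only: hcoeff_mult)
qed

lemma hurwitz_euler_fps: "hurwitz euler_fps"
proof -
  have "hcoeff euler_fps k \<in> \<int>" for k
  proof (induction k rule: less_induct)
    case (less k)
    show ?case
    proof (cases k)
      case 0
      thus ?thesis by (simp add: hcoeff_def)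
    next
      case (Suc j)
      show ?thesis unfolding Suc hcoeff_euler_fps_Suc
        by (intro Ints_diff Ints_sum Ints_mult less) (auto simp: Suc)
    qed
  qed
  thus ?thesis by (simp add: hurwitz_def)
qed

text \<open>
  The integer \<open>2 ^ k * E\<^sub>k(0)\<close> for the ordinary Euler polynomial \<open>E\<^sub>k\<close> of order 1; the floor
  only serves to land in the integers, see \<open>of_int_euler_num\<close> below.
\<close>
definition euler_num :: "nat \<Rightarrow> int" where
  "euler_num k = \<lfloor>hcoeff euler_fps k\<rfloor>"

lemma of_int_euler_num: "of_int (euler_num k) = hcoeff euler_fps k"
  using hurwitz_euler_fps by (simp add: euler_num_def hurwitz_def)

lemma hcoeff_euler_fps_power_Suc:
  "hcoeff (euler_fps ^ n) (Suc k) = of_nat n * hcoeff (euler_fps ^ n * (euler_fps - 2)) k"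
proof -
  have "fps_const 2 * fps_deriv (euler_fps ^ n) =
          fps_const (of_nat n) * (euler_fps ^ n * (euler_fps - 2))"
  proof (cases n)
    case (Suc m)
    have "fps_const 2 * fps_deriv (euler_fps ^ n) =
            fps_const (of_nat n) * (fps_const 2 * fps_deriv euler_fps) * euler_fps ^ m"
      unfolding fps_deriv_power by (simp add: Suc del: of_nat_Suc)
    also have "\<dots> = fps_const (of_nat n) * (euler_fps ^ n * (euler_fps - 2))"
      unfolding euler_fps_deriv by (simp add: Suc del: of_nat_Suc)
    finally show ?thesis .
  qed auto
  thus ?thesis by (simp only: hcoeff_Suc hcoeff_const_mult)
qed

lemma hurwitz_euler_fps_minus_2: "hurwitz (euler_fps - 2)"
  using hurwitz_diff[OF hurwitz_euler_fps hurwitz_const[of 2]]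
  by (simp add: fps_numeral_fps_const)

text \<open>
  The coefficients of positive index of an \<open>n\<close>-th power are those of its derivative, which has
  the factor \<open>n\<close>. Hence a prime dividing \<open>n\<close> divides all of them, and the congruence can be
  substituted into the derivative once more to reach second order in \<open>n\<close>.
\<close>
lemma euler_fps_power_cong_1:
  assumes "n > 0"
  obtains G where "hurwitz G" "euler_fps ^ n = 1 + fps_const (of_nat n) * G"
proof
  define G where "G = fps_const (1 / of_nat n) * (euler_fps ^ n - 1)"
  show "euler_fps ^ n = 1 + fps_const (of_nat n) * G"
    using assms by (simp add: G_def mult.assoc[symmetric])
  have "hcoeff G k \<in> \<int>" for k
  proof (cases k)
    case 0
    thus ?thesis by (simp add: G_def hcoeff_def fps_power_zeroth)
  next
    case (Suc j)
    have "hcoeff G k = hcoeff (euler_fps ^ n) (Suc j) / of_nat n"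
      unfolding G_def hcoeff_const_mult hcoeff_diff Suc by (simp add: hcoeff_def)
    also have "\<dots> = hcoeff (euler_fps ^ n * (euler_fps - 2)) j"
      using assms by (simp add: hcoeff_euler_fps_power_Suc)
    also have "\<dots> \<in> \<int>"
      using hurwitz_mult[OF hurwitz_power[OF hurwitz_euler_fps] hurwitz_euler_fps_minus_2]
      by (simp add: hurwitz_def)
    finally show ?thesis .
  qed
  thus "hurwitz G" by (simp add: hurwitz_def)
qed

text \<open>
  The derivative of \<open>euler_fps ^ n\<close> is, up to normalisation, \<open>n * euler_fps ^ n * (euler_fps - 2)\<close>,
  and by the previous lemma the power in it is 1 modulo \<open>n\<close>. So modulo \<open>n\<^sup>2\<close> the constant term of
  the \<open>n\<close>-th order polynomial, times \<open>2 ^ n\<close>, is \<open>n\<close> times an Euler number of order 1. The constant 2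
  contributes nothing because the index \<open>n - 1\<close> is positive.
\<close>
lemma hcoeff_euler_fps_power_diag:
  assumes "n \<ge> 2"
  shows "\<exists>z::int. hcoeff (euler_fps ^ n) n = of_int (int n * (euler_num (n - 1) + int n * z))"
proof -
  from assms have "n > 0" by simp
  from euler_fps_power_cong_1[OF this]
  obtain G where G: "hurwitz G" "euler_fps ^ n = 1 + fps_const (of_nat n) * G" .
  have H: "hurwitz (G * (euler_fps - 2))"
    by (intro hurwitz_mult G hurwitz_euler_fps_minus_2)
  then obtain z where z: "hcoeff (G * (euler_fps - 2)) (n - 1) = of_int z"
    by (auto simp: hurwitz_def Ints_def)
  have "hcoeff (euler_fps ^ n) n = hcoeff (euler_fps ^ n) (Suc (n - 1))"
    using assms by simp
  also have "\<dots> = of_nat n * hcoeff (euler_fps ^ n * (euler_fps - 2)) (n - 1)"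
    by (rule hcoeff_euler_fps_power_Suc)
  also have "euler_fps ^ n * (euler_fps - 2) =
      (euler_fps - fps_const 2) + fps_const (of_nat n) * (G * (euler_fps - 2))"
    unfolding G by (simp add: algebra_simps fps_numeral_fps_const)
  also have "hcoeff \<dots> (n - 1) = hcoeff euler_fps (n - 1) + of_nat n * of_int z"
    using assms unfolding hcoeff_add hcoeff_const_mult hcoeff_diff z
    by (simp add: hcoeff_def)
  finally show ?thesis
    by (intro exI[of _ z]) (simp add: of_int_euler_num)
qed

lemma coeff_euler_poly:
  assumes "j \<le> n"
  shows "coeff (euler_poly m n) j = of_nat (n choose j) * hcoeff (euler_fps ^ m) (n - j) / 2 ^ (n - j)"
proof -
  have "coeff (euler_poly m n) j =
    fact n * coeff (\<Sum>i=0..n. [:fps_nth (euler_fps ^ m) i:] * monom (1 / fact (n - i)) (n - i)) j"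
    by (simp add: euler_poly_def euler_gen_fun_def fps_mult_nth fps_to_poly_fps_def exp_tx_def
        euler_fps_def)
  also have "coeff (\<Sum>i=0..n. [:fps_nth (euler_fps ^ m) i:] * monom (1 / fact (n - i)) (n - i)) j
      = (\<Sum>i=0..n. if i = n - j then fps_nth (euler_fps ^ m) i / fact j else 0)"
    unfolding coeff_sum using assms by (intro sum.cong) auto
  also have "\<dots> = fps_nth (euler_fps ^ m) (n - j) / fact j"
    by simp
  also have "fact n * \<dots> = of_nat (n choose j) * hcoeff (euler_fps ^ m) (n - j) / 2 ^ (n - j)"
    by (simp add: hcoeff_def binomial_fact[OF assms])
  finally show ?thesis .
qed

lemma coeff_euler_poly_gt:
  assumes "j > n" shows "coeff (euler_poly m n) j = 0"
  using assms
  by (simp add: euler_poly_def euler_gen_fun_def fps_mult_nth fps_to_poly_fps_def exp_tx_def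
        euler_fps_def coeff_sum, intro sum.neutral, auto)

lemma coeff_euler_poly_top: "coeff (euler_poly m n) n = 1"
  by (simp add: coeff_euler_poly hcoeff_def fps_power_zeroth)

lemma degree_euler_poly: "degree (euler_poly m n) = n"
proof (rule antisym)
  show "degree (euler_poly m n) \<le> n" by (rule degree_le) (simp add: coeff_euler_poly_gt)
  show "n \<le> degree (euler_poly m n)" by (rule le_degree) (simp add: coeff_euler_poly_top)
qed

section \<open>Eisenstein form and Euler numbers of order one\<close>

text \<open>
  The valuation may be computed from any representation as a fraction, not only the reduced one.
\<close>
lemma padic_val_of_int_div:
  assumes p: "prime p" and "x \<noteq> 0" "y \<noteq> 0"
  shows "padic_val p (of_int x / of_int y) =
           ereal (real (multiplicity (int p) x) - real (multiplicity (int p) y))"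
proof -
  define q where "q = (of_int x / of_int y :: rat)"
  obtain a b where ab: "quotient_of q = (a, b)" by (cases "quotient_of q")
  have b: "b > 0" using quotient_of_denom_pos[OF ab] .
  have q: "q = of_int a / of_int b" using quotient_of_div[OF ab] .
  have "q \<noteq> 0" using assms by (simp add: q_def)
  hence a: "a \<noteq> 0" using q by auto
  have "of_int x * of_int b = (of_int a * of_int y :: rat)"
    using q b assms unfolding q_def by (simp add: field_simps)
  hence eq: "x * b = a * y"
    by (metis of_int_mult of_int_eq_iff)
  have P: "prime_elem (int p)" using p by simp
  have "multiplicity (int p) x + multiplicity (int p) b = multiplicity (int p) (x * b)"
    using assms b by (intro prime_elem_multiplicity_mult_distrib[symmetric] P) auto
  also have "\<dots> = multiplicity (int p) a + multiplicity (int p) y"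
    unfolding eq using assms a by (intro prime_elem_multiplicity_mult_distrib P) auto
  finally have "real (multiplicity (int p) x) + real (multiplicity (int p) b) =
                real (multiplicity (int p) a) + real (multiplicity (int p) y)"
    by (simp flip: of_nat_add)
  thus ?thesis using \<open>q \<noteq> 0\<close> ab
    by (simp add: padic_val_def flip: q_def)
qed

lemma multiplicity_2_power:
  assumes "prime p" "odd p" shows "multiplicity (int p) (2 ^ k) = 0"
proof (rule not_dvd_imp_multiplicity_0)
  show "\<not> int p dvd 2 ^ k"
  proof
    assume "int p dvd 2 ^ k"
    hence "int p dvd int (2 ^ k)" by simp
    hence "p dvd 2 ^ k" by (simp only: int_dvd_int_iff)
    hence "p dvd 2" by (rule prime_dvd_power[OF assms(1)])
    hence "p = 2" by (rule primes_dvd_imp_eq[OF assms(1) two_is_prime_nat])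
    thus False using assms by simp
  qed
qed

text \<open>
  Up to powers of 2, which are units at \<open>p\<close>, all non-leading coefficients are divisible by \<open>n\<close>,
  hence by \<open>p\<close>, and the constant coefficient is \<open>n\<close> times a number congruent to
  \<open>euler_num (n - 1)\<close> modulo \<open>p\<close>, so its valuation is that of \<open>n\<close> as soon as \<open>p\<close> does not divide this Euler number.
\<close>
theorem eisenstein_form_euler_poly:
  assumes p: "prime p" "odd p" and "p dvd n" "\<not> p\<^sup>2 dvd n"
    and e: "\<not> int p dvd euler_num (n - 1)"
  shows "eisenstein_form (euler_poly n n)"
proof -
  have n0: "n > 0" using assms by (intro Nat.gr0I) auto
  have "n \<ge> p" using assms n0 by (intro dvd_imp_le) auto
  hence n2: "n \<ge> 2" using prime_ge_2_nat[OF p(1)] by linarith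
  have P: "prime_elem (int p)" using p by simp
  have "padic_val p (coeff (euler_poly n n) j) \<ge> 1" if "j < n" for j
  proof -
    from euler_fps_power_cong_1[OF n0]
    obtain G where G: "hurwitz G" "euler_fps ^ n = 1 + fps_const (of_nat n) * G" .
    from G obtain z where z: "hcoeff G (n - j) = of_int z"
      by (auto simp: hurwitz_def Ints_def)
    have "hcoeff (euler_fps ^ n) (n - j) = hcoeff (1 + fps_const (of_nat n) * G) (n - j)"
      by (simp add: G)
    also have "\<dots> = of_nat n * of_int z"
      unfolding hcoeff_add hcoeff_const_mult z using that by (simp add: hcoeff_def)
    finally have c: "coeff (euler_poly n n) j
        = of_int (int (n choose j) * int n * z) / of_int (2 ^ (n - j))"
      using that by (simp add: coeff_euler_poly)
    show ?thesis
    proof (cases "int (n choose j) * int n * z = 0")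
      case True
      thus ?thesis unfolding c by (simp add: padic_val_def)
    next
      case False
      have "int p dvd int (n choose j) * int n * z" using \<open>p dvd n\<close> by simp
      hence "multiplicity (int p) (int (n choose j) * int n * z) \<ge> 1"
        using False p by (intro multiplicity_geI) (auto dest: prime_gt_1_nat)
      thus ?thesis unfolding c
        by (subst padic_val_of_int_div[OF p(1) False])
           (auto simp: multiplicity_2_power[OF p] one_ereal_def)
    qed
  qed
  moreover have "padic_val p (coeff (euler_poly n n) 0) = 1"
  proof -
    obtain z where z: "hcoeff (euler_fps ^ n) n = of_int (int n * (euler_num (n - 1) + int n * z))"
      using hcoeff_euler_fps_power_diag[OF n2] by blast
    have c: "coeff (euler_poly n n) 0
        = of_int (int n * (euler_num (n - 1) + int n * z)) / of_int (2 ^ n)"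
      by (simp add: coeff_euler_poly z)
    have nd: "\<not> int p dvd euler_num (n - 1) + int n * z"
      using e \<open>p dvd n\<close> by (simp add: dvd_add_left_iff)
    hence nz: "euler_num (n - 1) + int n * z \<noteq> 0" by auto
    have "multiplicity (int p) (int n) = 1"
    proof (rule multiplicity_eqI)
      show "int p ^ 1 dvd int n" using \<open>p dvd n\<close> by simp
      have "\<not> int (p ^ 2) dvd int n" using assms by (subst int_dvd_int_iff)
      thus "\<not> int p ^ Suc 1 dvd int n" by (simp add: power2_eq_square)
    qed
    hence "multiplicity (int p) (int n * (euler_num (n - 1) + int n * z)) = 1"
      using n0 nz by (subst prime_elem_multiplicity_mult_distrib[OF P])
        (use not_dvd_imp_multiplicity_0[OF nd] in auto)
    thus ?thesis unfolding c using n0 nz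
      by (subst padic_val_of_int_div[OF p(1)])
         (auto simp: multiplicity_2_power[OF p] one_ereal_def)
  qed
  moreover have "padic_val p 1 = 0"
    using padic_val_of_int_div[OF p(1), of 1 1] by simp
  ultimately show ?thesis
    using p n0 unfolding eisenstein_form_def eisenstein_form_wrt_def
    by (intro exI[of _ p]) (simp add: degree_euler_poly coeff_euler_poly_top)
qed

section \<open>Periodicity of Euler numbers modulo a prime\<close>

lemma hcoeff_fps_exp: "hcoeff (fps_exp c) k = (2 * c) ^ k"
  by (simp add: hcoeff_def power_mult_distrib)

text \<open>
  For odd \<open>p\<close> the geometric sum of \<open>(- exp t) ^ i\<close> over \<open>i < p\<close> is
  \<open>(1 + exp (p t)) / (1 + exp t)\<close>, and \<open>exp (p t)\<close> is 1 modulo \<open>p\<close>. So modulo \<open>p\<close> the generating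
  function is a finite alternating sum of exponentials.
\<close>
lemma euler_num_cong_alternating_sum:
  assumes "odd p"
  shows "int p dvd euler_num k - (\<Sum>i<p. (-1) ^ i * (2 * int i) ^ k)"
proof -
  define e where "e = (fps_exp 1 :: rat fps)"
  define G where "G = fps_const (1 / of_nat p) * (fps_exp (of_nat p) - 1 :: rat fps)"
  have p0: "p > 0" using assms by (intro Nat.gr0I) auto
  have G: "fps_exp (of_nat p) = 1 + fps_const (of_nat p) * G"
    using p0 by (simp add: G_def mult.assoc[symmetric])
  have "hcoeff G j \<in> \<int>" for j
  proof (cases j)
    case 0
    thus ?thesis by (simp add: G_def hcoeff_def)
  next
    case (Suc m)
    have "hcoeff G j = of_nat (2 ^ j * p ^ m)"
      using p0 unfolding G_def hcoeff_const_mult hcoeff_diff hcoeff_fps_exp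
      by (simp add: Suc hcoeff_def power_mult_distrib)
    thus ?thesis by simp
  qed
  hence "hurwitz (euler_fps * G)"
    by (intro hurwitz_mult hurwitz_euler_fps) (simp add: hurwitz_def)
  then obtain z where z: "hcoeff (euler_fps * G) k = of_int z"
    by (auto simp: hurwitz_def Ints_def)
  have neg_e: "(-e) ^ i = fps_const ((-1) ^ i) * fps_exp (of_nat i)" for i
    unfolding power_minus[of e] by (simp add: e_def fps_exp_power_mult flip: fps_const_power fps_const_neg)
  \<comment> \<open>Here the oddness of \<open>p\<close> enters.\<close>
  have "1 + fps_exp (of_nat p) = 1 - (-e) ^ p"
    using assms by (simp add: e_def fps_exp_power_mult)
  also have "\<dots> = (e + 1) * (\<Sum>i<p. (-e) ^ i)"
    by (subst one_diff_power_eq) (simp add: add.commute)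
  finally have "euler_fps * (1 + fps_exp (of_nat p)) = (euler_fps * (e + 1)) * (\<Sum>i<p. (-e) ^ i)"
    by (simp only: mult.assoc)
  also have "\<dots> = fps_const 2 * (\<Sum>i<p. fps_const ((-1) ^ i) * fps_exp (of_nat i))"
    unfolding neg_e unfolding e_def euler_fps_mult by (simp add: fps_numeral_fps_const)
  finally have "fps_const 2 * euler_fps + fps_const (of_nat p) * (euler_fps * G) =
     fps_const 2 * (\<Sum>i<p. fps_const ((-1) ^ i) * fps_exp (of_nat i))"
    unfolding G by (simp add: algebra_simps fps_numeral_fps_const)
  hence "hcoeff (fps_const 2 * euler_fps + fps_const (of_nat p) * (euler_fps * G)) k =
     hcoeff (fps_const 2 * (\<Sum>i<p. fps_const ((-1) ^ i) * fps_exp (of_nat i))) k"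
    by simp
  hence "2 * of_int (euler_num k) + of_nat p * of_int z =
           (2 * (\<Sum>i<p. (-1) ^ i * (2 * of_nat i) ^ k) :: rat)"
    unfolding hcoeff_add hcoeff_const_mult hcoeff_sum hcoeff_fps_exp z of_int_euler_num .
  hence "of_int (2 * euler_num k + int p * z) =
           (of_int (2 * (\<Sum>i<p. (-1) ^ i * (2 * int i) ^ k)) :: rat)"
    by simp
  hence "2 * euler_num k + int p * z = 2 * (\<Sum>i<p. (-1) ^ i * (2 * int i) ^ k)"
    by (simp only: of_int_eq_iff)
  hence "2 * (euler_num k - (\<Sum>i<p. (-1) ^ i * (2 * int i) ^ k)) = int p * (-z)"
    by simp
  hence "int p dvd 2 * (euler_num k - (\<Sum>i<p. (-1) ^ i * (2 * int i) ^ k))"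
    by simp
  moreover have "coprime (int p) 2" using assms by simp
  ultimately show ?thesis using coprime_dvd_mult_right_iff by blast
qed

lemma fermat_power_prime:
  fixes a p :: nat
  assumes "prime p"
  shows "[a ^ p = a] (mod p)"
proof (induction a)
  case 0
  from assms have "p > 0" by (rule prime_gt_0_nat)
  thus ?case by (simp add: zero_power)
next
  case (Suc a)
  have p: "p > 0" using assms by (simp add: prime_gt_0_nat)
  have "(Suc a) ^ p = (\<Sum>k\<le>p. (p choose k) * a ^ k)"
    using binomial[of a 1 p] by simp
  also have "{..p} = insert 0 (insert p {1..<p})" using p by auto
  also have "(\<Sum>k\<in>\<dots>. (p choose k) * a ^ k) = 1 + (a ^ p + (\<Sum>k\<in>{1..<p}. (p choose k) * a ^ k))"
    using p by simp
  finally have eq: "Suc a ^ p = 1 + (a ^ p + (\<Sum>k\<in>{1..<p}. (p choose k) * a ^ k))" .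
  have "p dvd (\<Sum>k\<in>{1..<p}. (p choose k) * a ^ k)"
    by (intro dvd_sum dvd_mult2 dvd_choose_prime) (use assms in auto)
  hence "[(\<Sum>k\<in>{1..<p}. (p choose k) * a ^ k) = 0] (mod p)"
    by (simp add: cong_0_iff)
  hence "[1 + (a ^ p + (\<Sum>k\<in>{1..<p}. (p choose k) * a ^ k)) = 1 + (a + 0)] (mod p)"
    by (intro cong_add Suc.IH) auto
  thus ?case unfolding eq by simp
qed

lemma power_cong_periodic:
  fixes x p a :: nat
  assumes "prime p" "a \<ge> 2"
  shows "[x ^ (p * a - 1) = x ^ (a - 1)] (mod p)"
proof -
  obtain b where a: "a = b + 2" using assms(2) by (metis add.commute le_Suc_ex)
  obtain q where p: "p = Suc q" using assms(1) by (cases p) auto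
  have "p * a - 1 = p * (b + 1) + q" by (simp add: a p)
  hence "x ^ (p * a - 1) = (x ^ p) ^ (b + 1) * x ^ q"
    by (simp only: power_add power_mult)
  also have "[\<dots> = x ^ (b + 1) * x ^ q] (mod p)"
    by (intro cong_mult cong_pow fermat_power_prime assms) auto
  also have "x ^ (b + 1) * x ^ q = x ^ b * x ^ p" by (simp add: p)
  also have "[\<dots> = x ^ b * x] (mod p)"
    by (intro cong_mult fermat_power_prime assms) auto
  finally show ?thesis by (simp add: a mult.commute)
qed

text \<open>
  By the alternating sum, Euler numbers inherit the period \<open>p - 1\<close> of power residues, and the
  indices \<open>p * a - 1\<close> and \<open>a - 1\<close> differ by a multiple of it. The bound \<open>a \<ge> 2\<close> keeps the
  smaller index positive, which the residue 0 requires.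
\<close>
lemma euler_num_kummer:
  assumes "prime p" "odd p" "a \<ge> 2"
  shows "int p dvd euler_num (p * a - 1) \<longleftrightarrow> int p dvd euler_num (a - 1)"
proof -
  have "[(2 * int i) ^ (p * a - 1) = (2 * int i) ^ (a - 1)] (mod int p)" for i
  proof -
    have "[int ((2 * i) ^ (p * a - 1)) = int ((2 * i) ^ (a - 1))] (mod int p)"
      unfolding cong_int_iff by (intro power_cong_periodic assms)
    thus ?thesis by simp
  qed
  hence 1: "[(\<Sum>i<p. (-1) ^ i * (2 * int i) ^ (p * a - 1)) =
         (\<Sum>i<p. (-1) ^ i * (2 * int i) ^ (a - 1))] (mod int p)"
    by (intro cong_sum cong_mult) auto
  have 2: "[euler_num k = (\<Sum>i<p. (-1) ^ i * (2 * int i) ^ k)] (mod int p)" for k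
    using euler_num_cong_alternating_sum[OF assms(2)] by (simp add: cong_iff_dvd_diff)
  have "[euler_num (p * a - 1) = euler_num (a - 1)] (mod int p)"
    using cong_trans[OF cong_trans[OF 2 1] cong_sym[OF 2]] .
  thus ?thesis by (rule cong_dvd_iff)
qed

section \<open>Sign and size of the Euler numbers of order one\<close>

text \<open>
  The series \<open>1 - euler_fps\<close> is \<open>tanh (t / 2)\<close>, so these are the signed tangent numbers. Up to sign
  they are the Euler numbers of positive index, but they satisfy a recurrence whose summands all
  have the same sign.
\<close>
definition tangent_coeff :: "nat \<Rightarrow> rat" where
  "tangent_coeff = hcoeff (1 - euler_fps)"

lemma tangent_coeff_0 [simp]: "tangent_coeff 0 = 0"
  by (simp add: tangent_coeff_def hcoeff_def)

text \<open>
  The differential equation \<open>tanh' = 1 - tanh\<^sup>2\<close>, read off coefficientwise.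
\<close>
lemma tangent_coeff_Suc:
  "tangent_coeff (Suc k) = (if k = 0 then 1 else 0) -
     (\<Sum>i\<le>k. of_nat (k choose i) * tangent_coeff i * tangent_coeff (k - i))"
proof -
  have "fps_const 2 * fps_deriv (1 - euler_fps) = - (fps_const 2 * fps_deriv euler_fps)"
    by simp
  also have "\<dots> = 1 - (1 - euler_fps) * (1 - euler_fps)"
    unfolding euler_fps_deriv by (simp add: algebra_simps)
  finally have "tangent_coeff (Suc k) = hcoeff (1 - (1 - euler_fps) * (1 - euler_fps)) k"
    by (simp only: tangent_coeff_def hcoeff_Suc)
  also have "\<dots> = hcoeff 1 k - (\<Sum>i\<le>k. of_nat (k choose i) * tangent_coeff i * tangent_coeff (k - i))"
    by (simp only: hcoeff_diff hcoeff_mult tangent_coeff_def)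
  finally show ?thesis by (simp add: hcoeff_def)
qed

text \<open>
  Replacing \<open>tanh\<close> by \<open>tan\<close> makes all coefficients nonnegative; the sign \<open>(-1) ^ (k div 2)\<close>
  performs this replacement. The summand with index 1 is then strictly positive, which excludes
  cancellation.
\<close>
lemma tangent_coeff_sign:
  "(even k \<longrightarrow> tangent_coeff k = 0) \<and> (odd k \<longrightarrow> (-1) ^ (k div 2) * tangent_coeff k > 0)"
proof (induction k rule: less_induct)
  case (less k)
  show ?case
  proof (cases k)
    case 0
    thus ?thesis by simp
  next
    case (Suc m)
    show ?thesis
    proof (cases "m = 0")
      case True
      thus ?thesis by (simp add: Suc tangent_coeff_Suc)
    next
      case m0: False
      have eq: "tangent_coeff k = - (\<Sum>i\<le>m. of_nat (m choose i) * tangent_coeff i * tangent_coeff (m - i))"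
        using m0 by (simp add: Suc tangent_coeff_Suc)
      have zero: "tangent_coeff i = 0" if "i \<le> m" "even i" for i
        using less[of i] that by (simp add: Suc)
      show ?thesis
      proof (cases "even k")
        case True
        hence "odd m" by (simp add: Suc)
        have "of_nat (m choose i) * tangent_coeff i * tangent_coeff (m - i) = 0" if "i \<le> m" for i
          using that \<open>odd m\<close> zero[of i] zero[of "m - i"] by (cases "even i") auto
        hence "tangent_coeff k = 0" unfolding eq by (simp add: sum.neutral)
        thus ?thesis using True by simp
      next
        case False
        hence m: "even m" by (simp add: Suc)
        define h where "h i = (-1) ^ (i div 2) * tangent_coeff i" for i
        have pos: "h i > 0" if "i \<le> m" "odd i" for i
          using less[of i] that by (simp add: Suc h_def)
        have term_eq: "- ((-1) ^ (k div 2)) * (of_nat (m choose i) * tangent_coeff i * tangent_coeff (m - i))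
                = of_nat (m choose i) * h i * h (m - i)" if "i \<le> m" "odd i" for i
        proof -
          from that obtain j where j: "i = 2 * j + 1" by (auto elim: oddE)
          from m obtain l where l: "m = 2 * l" by (auto elim: evenE)
          have "m - i = 2 * (l - j - 1) + 1" "l = j + (l - j - 1) + 1"
            using that j l by auto
          then obtain r where r: "m - i = 2 * r + 1" "l = j + r + 1" by blast
          have "k div 2 = l" by (simp add: Suc l)
          moreover have "i div 2 = j" "(m - i) div 2 = r" unfolding r(1) by (simp_all add: j)
          ultimately show ?thesis by (simp add: h_def r(2) power_add)
        qed
        have nonneg: "- ((-1) ^ (k div 2)) * (of_nat (m choose i) * tangent_coeff i * tangent_coeff (m - i)) \<ge> 0"
          if "i \<le> m" for i
        proof (cases "even i")
          case True
          thus ?thesis using zero[of i] that by simp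
        next
          case False
          thus ?thesis using term_eq[OF that False] pos[of i] pos[of "m - i"] that m by simp
        qed
        have "(-1) ^ (k div 2) * tangent_coeff k =
          (\<Sum>i\<le>m. - ((-1) ^ (k div 2)) * (of_nat (m choose i) * tangent_coeff i * tangent_coeff (m - i)))"
          unfolding eq by (simp add: sum_distrib_left sum_negf)
        also have "\<dots> > 0"
        proof (rule sum_pos2[of _ 1])
          have "m \<ge> 1" using m0 by simp
          moreover have "odd (m - 1)" using m m0 by auto
          ultimately show "- ((-1) ^ (k div 2)) * (of_nat (m choose 1) * tangent_coeff 1 * tangent_coeff (m - 1)) > 0"
            using pos[of 1] pos[of "m - 1"] by (subst term_eq) auto
        qed (use m0 nonneg in auto)
        finally show ?thesis using False by simp
      qed
    qed
  qed
qed

text \<open>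
  In the recurrence each of the \<open>m + 1\<close> summands is at most \<open>fact m\<close>.
\<close>
lemma tangent_coeff_le_fact: "\<bar>tangent_coeff k\<bar> \<le> fact k"
proof (induction k rule: less_induct)
  case (less k)
  show ?case
  proof (cases k)
    case 0
    thus ?thesis by simp
  next
    case (Suc m)
    show ?thesis
    proof (cases "m = 0")
      case True
      thus ?thesis by (simp add: Suc tangent_coeff_Suc)
    next
      case False
      hence "\<bar>tangent_coeff k\<bar> = \<bar>\<Sum>i\<le>m. of_nat (m choose i) * tangent_coeff i * tangent_coeff (m - i)\<bar>"
        by (simp add: Suc tangent_coeff_Suc)
      also have "\<dots> \<le> (\<Sum>i\<le>m. \<bar>of_nat (m choose i) * tangent_coeff i * tangent_coeff (m - i)\<bar>)"
        by (rule sum_abs)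
      also have "\<dots> \<le> (\<Sum>i\<le>m. fact m)"
      proof (rule sum_mono)
        fix i assume "i \<in> {..m}"
        hence i: "i \<le> m" by simp
        have "\<bar>of_nat (m choose i) * tangent_coeff i * tangent_coeff (m - i)\<bar>
                \<le> of_nat (m choose i) * fact i * fact (m - i)"
          unfolding abs_mult using i less[of i] less[of "m - i"] Suc
          by (intro mult_mono) auto
        also have "\<dots> = fact m" by (simp add: binomial_fact[OF i])
        finally show "\<bar>of_nat (m choose i) * tangent_coeff i * tangent_coeff (m - i)\<bar> \<le> fact m" .
      qed
      also have "\<dots> = fact k" by (simp add: Suc algebra_simps)
      finally show ?thesis .
    qed
  qed
qed

lemma of_int_euler_num_eq_tangent:
  assumes "k > 0" shows "of_int (euler_num k) = - tangent_coeff k"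
  using assms by (simp add: of_int_euler_num tangent_coeff_def hcoeff_def)

lemma euler_num_nonzero:
  assumes "odd k" shows "euler_num k \<noteq> 0"
proof
  assume "euler_num k = 0"
  moreover have "k > 0" using assms by (intro Nat.gr0I) auto
  ultimately have "tangent_coeff k = 0" using of_int_euler_num_eq_tangent[of k] by simp
  thus False using tangent_coeff_sign[of k] assms by simp
qed

lemma euler_num_le_fact: "\<bar>euler_num k\<bar> \<le> fact k"
proof (cases "k = 0")
  case True
  thus ?thesis by (simp add: euler_num_def hcoeff_def)
next
  case False
  hence "of_int \<bar>euler_num k\<bar> = \<bar>tangent_coeff k\<bar>"
    by (simp add: of_int_euler_num_eq_tangent)
  also have "\<dots> \<le> of_int (fact k)" using tangent_coeff_le_fact[of k] by simp
  finally show ?thesis by (simp only: of_int_le_iff)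
qed

lemma prod_primes_dvd:
  fixes N :: nat
  assumes "finite A" "\<And>p. p \<in> A \<Longrightarrow> prime p" "\<And>p. p \<in> A \<Longrightarrow> p dvd N"
  shows "\<Prod>A dvd N"
  using assms
proof (induction A rule: finite_induct)
  case (insert p A)
  have "coprime p (\<Prod>A)"
    using insert by (intro prod_coprime_right primes_coprime) auto
  hence "p * \<Prod>A dvd N" using insert by (intro divides_mult) auto
  thus ?case using insert by simp
qed auto

text \<open>
  Distinct primes dividing a nonzero integer have a product dividing it. With more than \<open>a\<close>
  of them above \<open>a\<close>, this product would exceed \<open>a ^ a\<close> and thus the factorial bound.
\<close>
lemma card_primes_gt_dvd_euler_num:
  assumes "even a" "a \<ge> 2"
  shows "finite {p. prime p \<and> a < p \<and> int p dvd euler_num (a - 1)}" (is "finite ?B")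
    and "card {p. prime p \<and> a < p \<and> int p dvd euler_num (a - 1)} \<le> a"
proof -
  define N where "N = nat \<bar>euler_num (a - 1)\<bar>"
  have N0: "N > 0" using euler_num_nonzero[of "a - 1"] assms by (simp add: N_def)
  have B: "?B \<subseteq> {p. p dvd N}"
    by (auto simp: N_def nat_dvd_iff nat_abs_dvd_iff int_dvd_int_iff[symmetric] simp del: int_dvd_int_iff)
  show fin: "finite ?B" using finite_subset[OF B] N0 by (simp add: finite_divisors_nat)
  have "a ^ card ?B = (\<Prod>p\<in>?B. a)" by simp
  also have "\<dots> \<le> \<Prod>?B" by (intro prod_mono) auto
  also have "\<Prod>?B \<le> N"
    using fin B N0 by (intro dvd_imp_le prod_primes_dvd) auto
  also have "N \<le> fact (a - 1)"
  proof -
    have "int N \<le> int (fact (a - 1))" using euler_num_le_fact[of "a - 1"] by (simp add: N_def)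
    thus ?thesis by (simp only: of_nat_le_iff)
  qed
  also have "\<dots> \<le> fact a" by (intro fact_mono) auto
  also have "\<dots> \<le> a ^ a" using fact_le_power[of a, where ?'a = nat] by simp
  finally show "card ?B \<le> a" using assms by (subst (asm) power_increasing_iff) auto
qed

section \<open>Irreducibility of polynomials in Eisenstein form\<close>

text \<open>
  The height of the point \<open>(j, multiplicity of the j-th coefficient)\<close> above the line of slope
  \<open>- 1 / n\<close> through the origin, scaled by \<open>n\<close>. An Eisenstein polynomial of
  degree \<open>n\<close> has a Newton polygon with this single slope. Weights of zero coefficients are meaningless and are excluded where weights are used.
\<close>
definition newton_weight :: "nat \<Rightarrow> int \<Rightarrow> int poly \<Rightarrow> nat \<Rightarrow> nat" where
  "newton_weight n p g j = n * multiplicity p (coeff g j) + j"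

lemma ex_first_minimal_weight:
  assumes "g \<noteq> 0"
  obtains j where "coeff g j \<noteq> 0"
    "\<And>i. coeff g i \<noteq> 0 \<Longrightarrow> newton_weight n p g j \<le> newton_weight n p g i"
    "\<And>i. coeff g i \<noteq> 0 \<Longrightarrow> i < j \<Longrightarrow> newton_weight n p g j < newton_weight n p g i"
proof -
  have "coeff g (degree g) \<noteq> 0" using assms by simp
  from ex_has_least_nat[of "\<lambda>i. coeff g i \<noteq> 0", OF this, of "newton_weight n p g"]
  obtain k where k: "coeff g k \<noteq> 0"
    "\<And>i. coeff g i \<noteq> 0 \<Longrightarrow> newton_weight n p g k \<le> newton_weight n p g i" by blast
  define P where "P i \<longleftrightarrow> coeff g i \<noteq> 0 \<and> newton_weight n p g i = newton_weight n p g k" for i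
  have "P k" using k by (simp add: P_def)
  hence least: "P (LEAST i. P i)" by (rule LeastI)
  show ?thesis
  proof (rule that[of "LEAST i. P i"])
    fix i assume i: "coeff g i \<noteq> 0" "i < (LEAST i. P i)"
    hence "\<not> P i" using not_less_Least by blast
    thus "newton_weight n p g (LEAST i. P i) < newton_weight n p g i"
      using least k(2)[OF i(1)] i(1) by (auto simp: P_def)
  qed (use least k in \<open>auto simp: P_def\<close>)
qed

text \<open>
  The minimal weight is additive under multiplication, as in the proof of the Gauss lemma: with
  the first indices of minimal weight in both factors, exactly one product in the
  convolution has the least multiplicity.
\<close>
lemma multiplicity_coeff_mult_first_minimal:
  fixes p :: int
  assumes p: "prime p" and "n > 0"
    and j: "coeff g j \<noteq> 0"
    "\<And>i. coeff g i \<noteq> 0 \<Longrightarrow> newton_weight n p g j \<le> newton_weight n p g i"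
    "\<And>i. coeff g i \<noteq> 0 \<Longrightarrow> i < j \<Longrightarrow> newton_weight n p g j < newton_weight n p g i"
    and k: "coeff h k \<noteq> 0"
    "\<And>i. coeff h i \<noteq> 0 \<Longrightarrow> newton_weight n p h k \<le> newton_weight n p h i"
    "\<And>i. coeff h i \<noteq> 0 \<Longrightarrow> i < k \<Longrightarrow> newton_weight n p h k < newton_weight n p h i"
  shows "coeff (g * h) (j + k) \<noteq> 0"
    and "multiplicity p (coeff (g * h) (j + k)) =
           multiplicity p (coeff g j) + multiplicity p (coeff h k)"
proof -
  have P: "prime_elem p" using p by (rule prime_imp_prime_elem)
  define v where "v = multiplicity p (coeff g j) + multiplicity p (coeff h k)"
  define rest where "rest = (\<Sum>i\<in>{..j+k}-{j}. coeff g i * coeff h (j + k - i))"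
  have split: "coeff (g * h) (j + k) = coeff g j * coeff h k + rest"
    unfolding coeff_mult rest_def by (subst sum.remove[of _ j]) auto
  have rest: "p ^ Suc v dvd rest"
    unfolding rest_def
  proof (rule dvd_sum)
    fix i assume i: "i \<in> {..j+k} - {j}"
    show "p ^ Suc v dvd coeff g i * coeff h (j + k - i)"
    proof (cases "coeff g i * coeff h (j + k - i) = 0")
      case False
      hence nz: "coeff g i \<noteq> 0" "coeff h (j + k - i) \<noteq> 0" by auto
      have "newton_weight n p g j + newton_weight n p h k
              < newton_weight n p g i + newton_weight n p h (j + k - i)"
      proof (cases "i < j")
        case True
        thus ?thesis using j(3)[OF nz(1)] k(2)[OF nz(2)] by (intro add_less_le_mono) auto
      next
        case False
        hence "j + k - i < k" using i by auto
        thus ?thesis using j(2)[OF nz(1)] k(3)[OF nz(2)] by (intro add_le_less_mono) auto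
      qed
      hence "n * v < n * (multiplicity p (coeff g i) + multiplicity p (coeff h (j + k - i)))"
        using i by (auto simp: newton_weight_def v_def algebra_simps)
      hence "Suc v \<le> multiplicity p (coeff g i) + multiplicity p (coeff h (j + k - i))"
        using \<open>n > 0\<close> by simp
      also have "\<dots> = multiplicity p (coeff g i * coeff h (j + k - i))"
        using nz by (simp add: prime_elem_multiplicity_mult_distrib[OF P])
      finally show ?thesis by (rule multiplicity_dvd')
    qed auto
  qed
  have main: "multiplicity p (coeff g j * coeff h k) = v"
    using j(1) k(1) by (simp add: v_def prime_elem_multiplicity_mult_distrib[OF P])
  have "\<not> p ^ Suc v dvd coeff g j * coeff h k"
    using main j(1) k(1) p
    by (subst power_dvd_iff_le_multiplicity) auto
  hence nd: "\<not> p ^ Suc v dvd coeff (g * h) (j + k)"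
    unfolding split using rest by (simp add: dvd_add_left_iff del: power_Suc)
  thus "coeff (g * h) (j + k) \<noteq> 0" by (metis dvd_0_right)
  have "p ^ v dvd coeff g j * coeff h k" using main multiplicity_dvd by metis
  moreover have "p ^ v dvd rest" using rest power_le_dvd[of p "Suc v" rest v] by simp
  ultimately have "p ^ v dvd coeff (g * h) (j + k)" unfolding split by simp
  thus "multiplicity p (coeff (g * h) (j + k)) = multiplicity p (coeff g j) + multiplicity p (coeff h k)"
    using nd unfolding v_def[symmetric] by (rule multiplicity_eqI)
qed

text \<open>
  The minimal weight of the product is attained at both ends of its Newton polygon, hence the same
  holds for each factor. Equating the weights at the two ends of \<open>g\<close> shows that \<open>n\<close> divides the
  degree of \<open>g\<close>. The shift \<open>M\<close> allows for the common multiplicity that clearing denominators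
  introduces.
\<close>
lemma eisenstein_int_mult:
  fixes p :: int and g h :: "int poly"
  defines "f \<equiv> g * h"
  assumes p: "prime p"
    and lead: "multiplicity p (lead_coeff f) = M"
    and mid: "\<And>j. j < degree f \<Longrightarrow> coeff f j \<noteq> 0 \<Longrightarrow> multiplicity p (coeff f j) \<ge> Suc M"
    and const: "coeff f 0 \<noteq> 0" "multiplicity p (coeff f 0) = Suc M"
  shows "degree g = 0 \<or> degree h = 0"
proof (rule ccontr)
  assume "\<not> (degree g = 0 \<or> degree h = 0)"
  hence deg: "degree g > 0" "degree h > 0" by auto
  have P: "prime_elem p" using p by (rule prime_imp_prime_elem)
  hence gh: "g \<noteq> 0" "h \<noteq> 0" using deg by auto
  define n where "n = degree f"
  have n: "n = degree g + degree h" using gh by (simp add: n_def f_def degree_mult_eq)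
  have "n > 0" using deg n by simp
  define w where "w = newton_weight n p"
  from ex_first_minimal_weight[OF gh(1), of n p] obtain j where j: "coeff g j \<noteq> 0"
    "\<And>i. coeff g i \<noteq> 0 \<Longrightarrow> w g j \<le> w g i"
    "\<And>i. coeff g i \<noteq> 0 \<Longrightarrow> i < j \<Longrightarrow> w g j < w g i"
    unfolding w_def by blast
  from ex_first_minimal_weight[OF gh(2), of n p] obtain k where k: "coeff h k \<noteq> 0"
    "\<And>i. coeff h i \<noteq> 0 \<Longrightarrow> w h k \<le> w h i"
    "\<And>i. coeff h i \<noteq> 0 \<Longrightarrow> i < k \<Longrightarrow> w h k < w h i"
    unfolding w_def by blast
  note jk = multiplicity_coeff_mult_first_minimal[OF p \<open>n > 0\<close> j[unfolded w_def] k[unfolded w_def],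
      folded f_def]
  \<comment> \<open>The Eisenstein conditions bound all weights of \<open>f\<close> below by the weight of its constant term.\<close>
  have "n * Suc M \<le> w f (j + k)"
  proof (cases "j + k < n")
    case True
    hence "Suc M \<le> multiplicity p (coeff f (j + k))" using jk(1) by (intro mid) (auto simp: n_def)
    thus ?thesis unfolding w_def newton_weight_def by (meson mult_le_mono2 trans_le_add1)
  next
    case False
    moreover have "j + k \<le> n" unfolding n_def using jk(1) by (rule le_degree)
    ultimately have "j + k = n" by simp
    thus ?thesis using lead by (simp add: w_def newton_weight_def n_def)
  qed
  also have "w f (j + k) = w g j + w h k"
    using jk(2) by (simp add: w_def newton_weight_def distrib_left)
  finally have lower: "n * Suc M \<le> w g j + w h k" .
  have c0: "coeff f 0 = coeff g 0 * coeff h 0" by (simp add: f_def coeff_mult)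
  hence nz0: "coeff g 0 \<noteq> 0" "coeff h 0 \<noteq> 0" using const by auto
  have "multiplicity p (coeff g 0) + multiplicity p (coeff h 0) = Suc M"
    using const nz0 unfolding c0 by (simp add: prime_elem_multiplicity_mult_distrib[OF P])
  hence "w g 0 + w h 0 = n * Suc M"
    by (simp add: w_def newton_weight_def flip: distrib_left)
  hence 1: "w g j = w g 0"
    using lower j(2)[OF nz0(1)] k(2)[OF nz0(2)] by linarith
  have nzl: "coeff g (degree g) \<noteq> 0" "coeff h (degree h) \<noteq> 0" using gh by auto
  have "multiplicity p (lead_coeff g) + multiplicity p (lead_coeff h) = M"
    using lead gh unfolding f_def lead_coeff_mult
    by (simp add: prime_elem_multiplicity_mult_distrib[OF P])
  hence "w g (degree g) + w h (degree h) = n * M + n"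
    unfolding w_def newton_weight_def n by (auto simp: algebra_simps)
  hence 2: "w g j = w g (degree g)"
    using lower j(2)[OF nzl(1)] k(2)[OF nzl(2)] by simp
  have "n * multiplicity p (coeff g 0) = n * multiplicity p (lead_coeff g) + degree g"
    using 1 2 by (simp add: w_def newton_weight_def)
  hence "n dvd degree g" by (metis dvd_add_right_iff dvd_triv_left)
  hence "n \<le> degree g" using deg by (intro dvd_imp_le)
  thus False using n deg by simp
qed

lemma clear_denominators:
  fixes g :: "rat poly"
  obtains c :: int and G :: "int poly"
  where "c \<noteq> 0" "\<And>j. of_int (coeff G j) = of_int c * coeff g j" "degree G = degree g"
proof -
  have "\<exists>c::int. \<exists>G::int poly. c \<noteq> 0 \<and> (\<forall>j. of_int (coeff G j) = of_int c * coeff g j)"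
  proof (induction g)
    case 0
    show ?case by (intro exI[of _ 1] exI[of _ 0]) auto
  next
    case (pCons a g)
    then obtain c G where cG: "c \<noteq> 0" "\<And>j. of_int (coeff G j) = of_int c * coeff g j" by blast
    obtain x y where xy: "quotient_of a = (x, y)" by (cases "quotient_of a")
    have y: "y > 0" using quotient_of_denom_pos[OF xy] .
    have a: "a = of_int x / of_int y" using quotient_of_div[OF xy] .
    show ?case
    proof (intro exI[of _ "c * y"] exI[of _ "pCons (c * x) (smult y G)"] conjI allI)
      fix j show "of_int (coeff (pCons (c * x) (smult y G)) j) = of_int (c * y) * coeff (pCons a g) j"
        using y by (cases j) (auto simp: a cG)
    qed (use cG y in auto)
  qed
  then obtain c G where cG: "c \<noteq> 0" "\<And>j. of_int (coeff G j) = of_int c * coeff g j" by blast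
  have "coeff G j = 0 \<longleftrightarrow> coeff g j = 0" for j
    using cG(2)[of j] cG(1) by (metis mult_eq_0_iff of_int_eq_0_iff)
  hence "degree G = degree g" by (simp add: degree_def)
  thus ?thesis using cG that by blast
qed

text \<open>
  After clearing denominators of both factors, the coefficients of the integer product are the
  rational ones times one common integer, so their multiplicities are shifted by a constant.
\<close>
theorem eisenstein_form_imp_irreducible:
  assumes "eisenstein_form f"
  shows "irreducible f"
proof -
  from assms obtain p where p: "prime p" and f: "degree f \<ge> 1"
    "padic_val p (lead_coeff f) = 0"
    "\<And>j. j < degree f \<Longrightarrow> padic_val p (coeff f j) \<ge> 1"
    "padic_val p (coeff f 0) = 1"
    by (auto simp: eisenstein_form_def eisenstein_form_wrt_def)
  have P: "prime (int p)" using p by simp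
  show ?thesis
  proof (rule irreducibleI)
    show "f \<noteq> 0" using f(1) by auto
    show "\<not> is_unit f" using f(1) by (auto simp: is_unit_iff_degree[OF \<open>f \<noteq> 0\<close>])
    fix g h assume fgh: "f = g * h"
    from clear_denominators[of g] obtain a G where
      G: "a \<noteq> 0" "\<And>j. of_int (coeff G j) = of_int a * coeff g j" "degree G = degree g"
      by blast
    from clear_denominators[of h] obtain b H where
      H: "b \<noteq> 0" "\<And>j. of_int (coeff H j) = of_int b * coeff h j" "degree H = degree h"
      by blast
    define F where "F = G * H"
    have F: "of_int (coeff F j) = of_int (a * b) * coeff f j" for j
      by (simp add: F_def fgh coeff_mult G(2) H(2) sum_distrib_left mult_ac)
    have F0: "coeff F j = 0 \<longleftrightarrow> coeff f j = 0" for j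
      using F[of j] G(1) H(1) by (metis mult_eq_0_iff of_int_eq_0_iff)
    hence degF: "degree F = degree f" by (simp add: degree_def)
    have val: "padic_val p (coeff f j) =
            ereal (real (multiplicity (int p) (coeff F j)) - real (multiplicity (int p) (a * b)))"
      if "coeff F j \<noteq> 0" for j
    proof -
      have "coeff f j = of_int (coeff F j) / of_int (a * b)"
        using G(1) H(1) F[of j] by simp
      thus ?thesis using padic_val_of_int_div[OF p that, of "a * b"] G(1) H(1) by simp
    qed
    have "degree G = 0 \<or> degree H = 0"
    proof (rule eisenstein_int_mult[OF P, where M = "multiplicity (int p) (a * b)"]; fold F_def)
      show "multiplicity (int p) (lead_coeff F) = multiplicity (int p) (a * b)"
        using val[of "degree F"] f(2) F0 \<open>f \<noteq> 0\<close> by (auto simp: degF zero_ereal_def)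
      show "multiplicity (int p) (coeff F j) \<ge> Suc (multiplicity (int p) (a * b))"
        if "j < degree F" "coeff F j \<noteq> 0" for j
        using val[OF that(2)] f(3)[of j] that(1) by (simp add: degF one_ereal_def)
      show nz: "coeff F 0 \<noteq> 0" using f(4) by (auto simp: F0 padic_val_def)
      show "multiplicity (int p) (coeff F 0) = Suc (multiplicity (int p) (a * b))"
        using val[OF nz] f(4) by (simp add: one_ereal_def)
    qed
    thus "is_unit g \<or> is_unit h"
      using \<open>f \<noteq> 0\<close> fgh G(3) H(3) by (auto simp: is_unit_iff_degree)
  qed
qed

lemma eisenstein_form_imp_eisenstein: "eisenstein_form f \<Longrightarrow> eisenstein f"
  unfolding eisenstein_def by (intro exI[of _ 0]) (simp add: pcompose_idR)

section \<open>Mertens' estimate for primes in an interval\<close>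

text \<open>
  Only the multiples \<open>p * k\<close> with \<open>k \<le> n div p\<close> contribute, each one more than \<open>k\<close> does. This form
  of Legendre's formula yields both bounds on the multiplicity that are needed below.
\<close>
lemma multiplicity_fact_recurrence:
  fixes p n :: nat
  assumes p: "prime p"
  shows "multiplicity p (fact n) = n div p + multiplicity p (fact (n div p))"
proof -
  have P: "prime_elem p" using p by (rule prime_imp_prime_elem)
  have p0: "p > 0" using p by (rule prime_gt_0_nat)
  have fact: "multiplicity p (fact m) = (\<Sum>k\<in>{1..m}. multiplicity p k)" for m
  proof -
    have "fact m = (\<Prod>k\<in>{1..m}. k)" by (simp add: fact_prod)
    thus ?thesis by (simp only:) (rule prime_elem_multiplicity_prod_distrib[OF P], auto)
  qed
  have "(\<Sum>k\<in>{1..n}. multiplicity p k) = (\<Sum>k\<in>(*) p ` {1..n div p}. multiplicity p k)"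
  proof (rule sum.mono_neutral_right)
    have "p * k \<le> n" if "k \<le> n div p" for k
      using that p0 by (simp add: less_eq_div_iff_mult_less_eq mult.commute)
    thus "(*) p ` {1..n div p} \<subseteq> {1..n}" using p0 by auto
    show "\<forall>k\<in>{1..n} - (*) p ` {1..n div p}. multiplicity p k = 0"
    proof
      fix k assume k: "k \<in> {1..n} - (*) p ` {1..n div p}"
      have "\<not> p dvd k"
      proof
        assume "p dvd k"
        then obtain j where j: "k = p * j" by (elim dvdE)
        have "j \<in> {1..n div p}"
          using k p0 by (auto simp: j less_eq_div_iff_mult_less_eq mult.commute)
        thus False using k j by auto
      qed
      thus "multiplicity p k = 0" by (rule not_dvd_imp_multiplicity_0)
    qed
  qed auto
  also have "\<dots> = (\<Sum>k\<in>{1..n div p}. multiplicity p (p * k))"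
    using p0 by (subst sum.reindex) (auto simp: inj_on_def)
  also have "\<dots> = (\<Sum>k\<in>{1..n div p}. Suc (multiplicity p k))"
    by (intro sum.cong) (use p0 in \<open>auto simp: prime_elem_multiplicity_mult_distrib[OF P] multiplicity_prime[OF P]\<close>)
  also have "\<dots> = n div p + (\<Sum>k\<in>{1..n div p}. multiplicity p k)"
    by (simp add: sum_Suc)
  finally show ?thesis by (simp only: fact)
qed

lemma multiplicity_fact_upper:
  fixes p n :: nat
  assumes p: "prime p"
  shows "(p - 1) * multiplicity p (fact n) \<le> n"
proof (induction n rule: less_induct)
  case (less n)
  show ?case
  proof (cases "n = 0")
    case False
    have p1: "p > 1" using p by (rule prime_gt_1_nat)
    have "(p - 1) * multiplicity p (fact n) = (p - 1) * (n div p) + (p - 1) * multiplicity p (fact (n div p))"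
      by (subst multiplicity_fact_recurrence[OF p]) (rule distrib_left)
    also have "\<dots> \<le> (p - 1) * (n div p) + n div p"
      using False p1 by (intro add_left_mono less) auto
    also have "\<dots> = p * (n div p)"
      using p1 by (cases p) auto
    also have "\<dots> \<le> n" by simp
    finally show ?thesis .
  qed auto
qed

lemma ln_fact_eq_sum_primes:
  "ln (fact n) = (\<Sum>p | prime p \<and> p \<le> n. real (multiplicity p (fact n)) * ln (real p))"
proof -
  have pf: "prime_factors (fact n :: nat) = {p. prime p \<and> p \<le> n}"
    by (auto simp: prime_factors_dvd prime_dvd_fact_iff)
  have "(fact n :: nat) = (\<Prod>p\<in>{p. prime p \<and> p \<le> n}. p ^ multiplicity p (fact n))"
    unfolding pf[symmetric] by (rule prime_factorization_nat) simp
  hence "(fact n :: real) = (\<Prod>p\<in>{p. prime p \<and> p \<le> n}. real p ^ multiplicity p (fact n))"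
    by (metis (mono_tags, lifting) of_nat_fact of_nat_power of_nat_prod prod.cong)
  hence "ln (fact n) = ln (\<Prod>p\<in>{p. prime p \<and> p \<le> n}. real p ^ multiplicity p (fact n))"
    by simp
  also have "\<dots> = (\<Sum>p | prime p \<and> p \<le> n. ln (real p ^ multiplicity p (fact n)))"
    by (rule ln_prod) (auto dest: prime_gt_0_nat)
  also have "\<dots> = (\<Sum>p | prime p \<and> p \<le> n. real (multiplicity p (fact n)) * ln (real p))"
    by (intro sum.cong) (auto simp: ln_realpow dest: prime_gt_0_nat)
  finally show ?thesis .
qed

lemma ln_fact_le: "ln (fact n) \<le> real n * ln (real n)"
proof (cases "n = 0")
  case False
  have "fact n \<le> real (n ^ n)" using fact_le_power[of n, where ?'a = real] by simp
  hence "ln (fact n) \<le> ln (real n ^ n)" using False by simp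
  thus ?thesis using False by (simp add: ln_realpow)
qed auto

lemma ln_fact_ge: "n > 0 \<Longrightarrow> ln (fact n) \<ge> real n * ln (real n) - real n"
proof (induction n rule: nat_induct_non_zero)
  case (Suc n)
  have "real n * ln (1 + 1 / real n) \<le> real n * (1 / real n)"
    by (intro mult_left_mono ln_add_one_self_le_self) auto
  also have "1 + 1 / real n = real (Suc n) / real n" using Suc by (simp add: field_simps)
  finally have "real n * ln (real (Suc n)) - real n * ln (real n) \<le> 1"
    using Suc.hyps by (subst (asm) ln_div) (auto simp: algebra_simps)
  moreover have "ln (fact (Suc n)) = ln (real (Suc n)) + ln (fact n)"
    by (simp add: ln_mult del: of_nat_Suc)
  ultimately show ?case using Suc.IH by (simp add: algebra_simps)
qed auto

text \<open>
  This coefficient occurs twice in a row of sum \<open>2 * 4 ^ m\<close>.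
\<close>
lemma binomial_odd_le: "(2 * m + 1) choose m \<le> 4 ^ m"
proof -
  have "(2 * m + 1) choose (m + 1) = (2 * m + 1) choose m"
    by (subst binomial_symmetric) auto
  hence "2 * ((2 * m + 1) choose m) = (\<Sum>k\<in>{m, m + 1}. (2 * m + 1) choose k)" by simp
  also have "\<dots> \<le> (\<Sum>k\<le>2 * m + 1. (2 * m + 1) choose k)"
    by (intro sum_mono2) auto
  also have "\<dots> = 2 * 4 ^ m"
    by (simp only: choose_row_sum) (simp add: power_mult)
  finally show ?thesis by simp
qed

text \<open>
  Erdos' argument: all primes above \<open>m + 1\<close> and up to \<open>2 * m + 1\<close> divide the binomial
  coefficient \<open>(2 * m + 1) choose m\<close>, and even numbers above 2 add no prime.
\<close>
lemma primorial_le: "(\<Prod>{p::nat. prime p \<and> p \<le> n}) \<le> 4 ^ n"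
proof (induction n rule: less_induct)
  case (less n)
  consider "n \<le> 1" | "n = 2" | "n > 2" "even n" | m where "n = 2 * m + 1" "m > 0"
  proof -
    assume a: "n \<le> 1 \<Longrightarrow> thesis" "n = 2 \<Longrightarrow> thesis" "2 < n \<Longrightarrow> even n \<Longrightarrow> thesis"
      "\<And>m. n = 2 * m + 1 \<Longrightarrow> 0 < m \<Longrightarrow> thesis"
    show thesis
    proof (cases "even n")
      case True
      thus ?thesis using a(1-3) by linarith
    next
      case False
      then obtain m where "n = 2 * m + 1" by (elim oddE)
      thus ?thesis using a(1) a(4)[of m] by (cases "m = 0") auto
    qed
  qed
  thus ?case
  proof cases
    case 1
    hence "{p::nat. prime p \<and> p \<le> n} = {}" by (auto dest: prime_ge_2_nat)
    thus ?thesis by (simp only: prod.empty) simp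
  next
    case 2
    hence "{p::nat. prime p \<and> p \<le> n} = {2}" by (auto dest: prime_ge_2_nat)
    thus ?thesis using 2 by simp
  next
    case 3
    hence "\<not> prime n" using prime_odd_nat by blast
    hence "{p::nat. prime p \<and> p \<le> n} = {p. prime p \<and> p \<le> n - 1}"
      by (auto simp: le_less intro: ccontr)
    hence "(\<Prod>{p::nat. prime p \<and> p \<le> n}) \<le> 4 ^ (n - 1)"
      using less[of "n - 1"] 3 by simp
    also have "\<dots> \<le> 4 ^ n" by (intro power_increasing) auto
    finally show ?thesis .
  next
    case (4 m)
    define A where "A = {p::nat. prime p \<and> m + 1 < p \<and> p \<le> n}"
    have fin: "finite A" by (rule finite_subset[of _ "{..n}"]) (auto simp: A_def)
    have "{p::nat. prime p \<and> p \<le> n} = {p. prime p \<and> p \<le> m + 1} \<union> A"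
      using 4 by (auto simp: A_def)
    hence "(\<Prod>{p::nat. prime p \<and> p \<le> n}) = (\<Prod>{p::nat. prime p \<and> p \<le> m + 1}) * \<Prod>A"
      using fin by (simp only:) (subst prod.union_disjoint, auto simp: A_def)
    also have "\<dots> \<le> 4 ^ (m + 1) * 4 ^ m"
    proof (intro mult_mono)
      show "(\<Prod>{p::nat. prime p \<and> p \<le> m + 1}) \<le> 4 ^ (m + 1)" using 4 by (intro less) auto
      have "\<Prod>A dvd (n choose m)"
      proof (rule prod_primes_dvd[OF fin])
        fix p assume p: "p \<in> A"
        thus "prime p" by (simp add: A_def)
        have "fact m * fact (m + 1) * (n choose m) = (fact n :: nat)"
          using binomial_fact_lemma[of m n] 4 by simp
        moreover have "p dvd fact n" using p by (simp add: A_def prime_dvd_fact_iff)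
        ultimately have "p dvd fact m * fact (m + 1) * (n choose m)" by simp
        moreover have "\<not> p dvd fact m" "\<not> p dvd fact (m + 1)"
          using p by (auto simp: A_def prime_dvd_fact_iff simp del: fact_Suc)
        ultimately show "p dvd (n choose m)"
          using \<open>prime p\<close> by (simp add: prime_dvd_mult_iff del: fact_Suc)
      qed
      hence "\<Prod>A \<le> (n choose m)" using 4 by (intro dvd_imp_le) auto
      also have "\<dots> \<le> 4 ^ m" using binomial_odd_le 4 by simp
      finally show "\<Prod>A \<le> 4 ^ m" .
    qed auto
    also have "\<dots> = 4 ^ n" using 4 by (simp add: mult_2 flip: power_add)
    finally show ?thesis .
  qed
qed

lemma sum_ln_primes_le: "(\<Sum>p | prime p \<and> p \<le> n. ln (real p)) \<le> real n * ln 4"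
proof -
  have "(\<Sum>p | prime p \<and> p \<le> n. ln (real p)) = ln (\<Prod>p | prime p \<and> p \<le> n. real p)"
    by (rule ln_prod[symmetric]) (auto dest: prime_gt_0_nat)
  also have "(\<Prod>p | prime p \<and> p \<le> n. real p) = real (\<Prod>{p. prime p \<and> p \<le> n})" by simp
  also have "ln \<dots> \<le> ln (real (4 ^ n))"
  proof (subst ln_le_cancel_iff)
    show "real (\<Prod>{p. prime p \<and> p \<le> n}) \<le> real (4 ^ n)"
      using primorial_le[of n] by (simp only: of_nat_le_iff)
    show "0 < real (\<Prod>{p. prime p \<and> p \<le> n})"
      by (simp only: of_nat_0_less_iff) (auto intro!: prod_pos dest: prime_gt_0_nat)
  qed auto
  also have "\<dots> = real n * ln 4" by (simp add: ln_realpow)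
  finally show ?thesis .
qed

text \<open>
  Each quotient \<open>n / p\<close> is at most the multiplicity of \<open>p\<close> in \<open>fact n\<close> plus 1. Weighted by
  \<open>ln p\<close>, the multiplicities sum to \<open>ln (fact n)\<close>, and the errors 1 to Chebyshev's function, which is linear in \<open>n\<close>.
\<close>
lemma mertens_upper:
  assumes "n > 0"
  shows "(\<Sum>p | prime p \<and> p \<le> n. ln (real p) / real p) \<le> ln (real n) + ln 4"
proof -
  have "real n * (\<Sum>p | prime p \<and> p \<le> n. ln (real p) / real p)
          = (\<Sum>p | prime p \<and> p \<le> n. real n / real p * ln (real p))"
    by (simp add: sum_distrib_left)
  also have "\<dots> \<le> (\<Sum>p | prime p \<and> p \<le> n. (real (multiplicity p (fact n)) + 1) * ln (real p))"
  proof (intro sum_mono mult_right_mono)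
    fix p assume "p \<in> {p. prime p \<and> p \<le> n}"
    hence p: "prime p" by simp
    show "ln (real p) \<ge> 0" using prime_gt_0_nat[OF p] by simp
    have "real n / real p \<le> real (n div p) + 1"
    proof -
      have "n \<le> (n div p + 1) * p"
        using dividend_less_div_times[of p n] prime_gt_0_nat[OF p] by simp
      hence "real n \<le> real ((n div p + 1) * p)" by (simp only: of_nat_le_iff)
      thus ?thesis using prime_gt_0_nat[OF p] by (simp add: field_simps)
    qed
    also have "n div p \<le> multiplicity p (fact n)"
      using multiplicity_fact_recurrence[OF p, of n] by simp
    finally show "real n / real p \<le> real (multiplicity p (fact n)) + 1" by simp
  qed
  also have "\<dots> = ln (fact n) + (\<Sum>p | prime p \<and> p \<le> n. ln (real p))"
    by (simp add: ln_fact_eq_sum_primes algebra_simps sum.distrib)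
  also have "\<dots> \<le> real n * ln (real n) + real n * ln 4"
    by (intro add_mono ln_fact_le sum_ln_primes_le)
  also have "\<dots> = real n * (ln (real n) + ln 4)" by (simp add: algebra_simps)
  finally show ?thesis using assms by simp
qed

text \<open>
  The right-hand side telescopes: its increment from \<open>n\<close> to \<open>n + 1\<close> dominates the new summand.
\<close>
lemma sum_ln_div_le:
  assumes "n > 0"
  shows "(\<Sum>k=2..n. ln (real k) / (real k * (real k - 1))) \<le> 2 - (ln (real n) + 2) / real n"
  using assms
proof (induction n rule: nat_induct_non_zero)
  case (Suc n)
  have "real (Suc n) * ln (real (Suc n) / real n) \<le> real (Suc n) * (1 / real n)"
  proof (intro mult_left_mono)
    have "real (Suc n) / real n = 1 + 1 / real n" using Suc.hyps by (simp add: field_simps)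
    thus "ln (real (Suc n) / real n) \<le> 1 / real n"
      using ln_add_one_self_le_self[of "1 / real n"] by simp
  qed auto
  also have "\<dots> \<le> 2" using Suc.hyps by (simp add: field_simps)
  finally have "real (Suc n) * ln (real (Suc n)) - real (Suc n) * ln (real n) \<le> 2"
    using Suc.hyps by (subst (asm) ln_div) (auto simp: algebra_simps)
  hence "ln (real (Suc n)) / (real (Suc n) * real n)
          \<le> (ln (real n) + 2) / real n - (ln (real (Suc n)) + 2) / real (Suc n)"
  proof -
    have "ln (real (Suc n)) / (real (Suc n) * real n)
        \<le> (real (Suc n) * (ln (real n) + 2) - real n * (ln (real (Suc n)) + 2)) / (real (Suc n) * real n)"
      using \<open>real (Suc n) * ln (real (Suc n)) - real (Suc n) * ln (real n) \<le> 2\<close>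
      by (intro divide_right_mono) (auto simp: algebra_simps)
    also have "\<dots> = (ln (real n) + 2) / real n - (ln (real (Suc n)) + 2) / real (Suc n)"
      using Suc.hyps by (simp add: diff_frac_eq mult.commute del: of_nat_Suc)
    finally show ?thesis .
  qed
  moreover have "(\<Sum>k=2..Suc n. ln (real k) / (real k * (real k - 1)))
      = (\<Sum>k=2..n. ln (real k) / (real k * (real k - 1))) + ln (real (Suc n)) / (real (Suc n) * real n)"
    using Suc.hyps by (subst sum.cl_ivl_Suc) auto
  ultimately show ?case using Suc.IH by linarith
qed auto

text \<open>
  Conversely the multiplicity of \<open>p\<close> in \<open>fact n\<close> is at most \<open>n / (p - 1)\<close>, and replacing
  \<open>p - 1\<close> by \<open>p\<close> costs only a convergent series.
\<close>
lemma mertens_lower: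
  assumes "n > 0"
  shows "(\<Sum>p | prime p \<and> p \<le> n. ln (real p) / real p) \<ge> ln (real n) - 3"
proof -
  have "real n * ln (real n) - real n \<le> ln (fact n)" by (rule ln_fact_ge[OF assms])
  also have "\<dots> = (\<Sum>p | prime p \<and> p \<le> n. real (multiplicity p (fact n)) * ln (real p))"
    by (rule ln_fact_eq_sum_primes)
  also have "\<dots> \<le> (\<Sum>p | prime p \<and> p \<le> n. real n / (real p - 1) * ln (real p))"
  proof (intro sum_mono mult_right_mono)
    fix p assume "p \<in> {p. prime p \<and> p \<le> n}"
    hence p: "prime p" by simp
    note p1 = prime_gt_1_nat[OF p]
    show "ln (real p) \<ge> 0" using p1 by simp
    have "real ((p - 1) * multiplicity p (fact n)) \<le> real n"
      using multiplicity_fact_upper[OF p] by (simp only: of_nat_le_iff)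
    thus "real (multiplicity p (fact n)) \<le> real n / (real p - 1)"
      using p1 by (simp add: field_simps of_nat_diff)
  qed
  also have "\<dots> = (\<Sum>p | prime p \<and> p \<le> n. real n * (ln (real p) / real p) +
                      real n * (ln (real p) / (real p * (real p - 1))))"
  proof (intro sum.cong refl)
    fix p assume "p \<in> {p. prime p \<and> p \<le> n}"
    hence "p > 1" using prime_gt_1_nat by blast
    hence "real p > 0" "real p - 1 > 0" by auto
    thus "real n / (real p - 1) * ln (real p) = real n * (ln (real p) / real p) +
                      real n * (ln (real p) / (real p * (real p - 1)))"
      by (simp add: field_simps)
  qed
  also have "\<dots> = real n * (\<Sum>p | prime p \<and> p \<le> n. ln (real p) / real p) +
                  real n * (\<Sum>p | prime p \<and> p \<le> n. ln (real p) / (real p * (real p - 1)))"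
    by (simp add: sum.distrib sum_distrib_left)
  also have "(\<Sum>p | prime p \<and> p \<le> n. ln (real p) / (real p * (real p - 1)))
               \<le> (\<Sum>k=2..n. ln (real k) / (real k * (real k - 1)))"
    by (intro sum_mono2) (auto dest: prime_ge_2_nat)
  also have "\<dots> \<le> 2"
    using sum_ln_div_le[OF assms] assms
    by (smt (verit) divide_nonneg_nonneg ln_ge_zero of_nat_0_le_iff of_nat_1 of_nat_le_iff Suc_leI One_nat_def)
  finally have "real n * ln (real n) - real n
      \<le> real n * (\<Sum>p | prime p \<and> p \<le> n. ln (real p) / real p) + real n * 2"
    by (simp add: mult_left_mono)
  hence "real n * (ln (real n) - 3) \<le> real n * (\<Sum>p | prime p \<and> p \<le> n. ln (real p) / real p)"
    by (simp add: algebra_simps)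
  thus ?thesis using assms by simp
qed

definition primes_between :: "real \<Rightarrow> real \<Rightarrow> nat set" where
  "primes_between x y = {p. prime p \<and> x < real p \<and> real p \<le> y}"

lemma finite_primes_between [simp]: "finite (primes_between x y)"
  by (rule finite_subset[of _ "{..nat \<lfloor>y\<rfloor>}"]) (auto simp: primes_between_def le_nat_floor)

lemma sum_ln_div_primes_between_ge:
  assumes "1 \<le> x" "x \<le> y"
  shows "(\<Sum>p\<in>primes_between x y. ln (real p) / real p) \<ge> ln y - ln x - 6"
proof -
  define M where "M z = (\<Sum>p | prime p \<and> p \<le> nat \<lfloor>z\<rfloor>. ln (real p) / real p)" for z :: real
  have fl: "p \<le> nat \<lfloor>z\<rfloor> \<longleftrightarrow> real p \<le> z" if "z \<ge> 1" for p z
    using that by (simp add: le_nat_iff le_floor_iff)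
  have "{p. prime p \<and> p \<le> nat \<lfloor>y\<rfloor>} = {p. prime p \<and> p \<le> nat \<lfloor>x\<rfloor>} \<union> primes_between x y"
    using assms by (auto simp: fl primes_between_def)
  hence "M y = (\<Sum>p\<in>{p. prime p \<and> p \<le> nat \<lfloor>x\<rfloor>} \<union> primes_between x y. ln (real p) / real p)"
    by (simp only: M_def)
  also have "\<dots> = M x + (\<Sum>p\<in>primes_between x y. ln (real p) / real p)"
    unfolding M_def
  proof (rule sum.union_disjoint)
    show "{p. prime p \<and> p \<le> nat \<lfloor>x\<rfloor>} \<inter> primes_between x y = {}"
      using assms by (auto simp: fl primes_between_def)
  qed auto
  finally have eq: "(\<Sum>p\<in>primes_between x y. ln (real p) / real p) = M y - M x" by simp
  have "nat \<lfloor>x\<rfloor> > 0" "nat \<lfloor>y\<rfloor> > 0" using assms by auto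
  have "M x \<le> ln (real (nat \<lfloor>x\<rfloor>)) + ln 4" unfolding M_def by (rule mertens_upper) fact
  also have "ln (real (nat \<lfloor>x\<rfloor>)) \<le> ln x"
    using assms \<open>nat \<lfloor>x\<rfloor> > 0\<close> by (subst ln_le_cancel_iff) auto
  finally have Mx: "M x \<le> ln x + ln 4" by simp
  have "ln y - ln 2 = ln (y / 2)" using assms by (simp add: ln_div)
  also have "\<dots> \<le> ln (real (nat \<lfloor>y\<rfloor>))"
  proof -
    have "\<lfloor>y\<rfloor> \<ge> 1" using assms by (simp add: le_floor_iff)
    hence "real_of_int \<lfloor>y\<rfloor> \<ge> 1" "real_of_int \<lfloor>y\<rfloor> > y - 1" by linarith+
    moreover have "real (nat \<lfloor>y\<rfloor>) = real_of_int \<lfloor>y\<rfloor>" using \<open>\<lfloor>y\<rfloor> \<ge> 1\<close> by simp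
    ultimately have "y / 2 \<le> real (nat \<lfloor>y\<rfloor>)" by linarith
    thus ?thesis using assms by (intro ln_mono) auto
  qed
  also have "\<dots> - 3 \<le> M y" unfolding M_def by (rule mertens_lower) fact
  finally have My: "ln y - ln 2 - 3 \<le> M y" by simp
  have "ln (4::real) = 2 * ln 2" using ln_realpow[of 2 2] by simp
  thus ?thesis using Mx My ln2_le_25_over_36 unfolding eq by simp
qed

lemma sum_inverse_primes_between_ge:
  assumes "1 \<le> x" "x \<le> y" "y > 1"
  shows "(\<Sum>p\<in>primes_between x y. 1 / real p) \<ge> (ln y - ln x - 6) / ln y"
proof -
  have "ln y - ln x - 6 \<le> (\<Sum>p\<in>primes_between x y. ln (real p) / real p)"
    using assms by (intro sum_ln_div_primes_between_ge)
  also have "\<dots> \<le> (\<Sum>p\<in>primes_between x y. ln y * (1 / real p))"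
  proof (rule sum_mono)
    fix p assume "p \<in> primes_between x y"
    hence "real p > 0" "real p \<le> y" using assms by (auto simp: primes_between_def prime_gt_0_nat)
    thus "ln (real p) / real p \<le> ln y * (1 / real p)"
      by (simp add: divide_right_mono)
  qed
  also have "\<dots> = ln y * (\<Sum>p\<in>primes_between x y. 1 / real p)"
    by (simp add: sum_distrib_left)
  finally show ?thesis using assms by (simp add: divide_le_eq mult.commute)
qed

text \<open>
  On an interval from \<open>z\<close> to \<open>z powr r\<close>, Mertens' estimate divided by the logarithm of the right
  end point gives \<open>1 - 1 / r\<close> up to \<open>O(1 / ln t)\<close>. Intervals of this kind are concatenated: for
  \<open>r\<close> close to 1 this is a Riemann sum for the integral of \<open>1 / u\<close>, in place of a partial summation.
\<close>
lemma sum_inverse_primes_geometric: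
  assumes r: "r > 1" and t: "t > 1"
  shows "(\<Sum>p\<in>primes_between (t powr (r / 2)) (t powr (r ^ Suc k / 2)). 1 / real p)
           \<ge> real k * (1 - 1 / r - 12 / ln t)"
proof (induction k)
  case 0
  show ?case by (auto intro!: sum_nonneg)
next
  case (Suc k)
  define z where "z i = t powr (r ^ i / 2)" for i
  have z1: "z i > 1" for i unfolding z_def using r t by (intro gr_one_powr) auto
  have z_mono: "z i \<le> z j" if "i \<le> j" for i j
    unfolding z_def using that r t by (intro powr_mono divide_right_mono power_increasing) auto
  have ln_z: "ln (z i) = r ^ i / 2 * ln t" for i unfolding z_def using t by (simp add: ln_powr)
  have lnt: "ln t > 0" using t by simp
  have "1 - 1 / r - 12 / ln t \<le> (ln (z (Suc (Suc k))) - ln (z (Suc k)) - 6) / ln (z (Suc (Suc k)))"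
  proof -
    have pos: "r ^ Suc k > 0" "r ^ Suc (Suc k) \<ge> 1" using r by (auto intro: one_le_power simp del: power_Suc)
    have "(ln (z (Suc (Suc k))) - ln (z (Suc k)) - 6) / ln (z (Suc (Suc k)))
            = 1 - 1 / r - 12 / ln t / r ^ Suc (Suc k)"
      using r lnt by (simp add: ln_z field_simps)
    moreover have "12 / ln t / r ^ Suc (Suc k) \<le> 12 / ln t / 1"
      using pos lnt by (intro divide_left_mono) auto
    ultimately show ?thesis by simp
  qed
  also have "\<dots> \<le> (\<Sum>p\<in>primes_between (z (Suc k)) (z (Suc (Suc k))). 1 / real p)"
    using z1 less_imp_le by (intro sum_inverse_primes_between_ge z_mono) auto
  finally have "real (Suc k) * (1 - 1 / r - 12 / ln t)
     \<le> (\<Sum>p\<in>primes_between (z 1) (z (Suc k)). 1 / real p)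
        + (\<Sum>p\<in>primes_between (z (Suc k)) (z (Suc (Suc k))). 1 / real p)"
    using Suc.IH by (simp add: z_def distrib_right)
  also have "\<dots> = (\<Sum>p\<in>primes_between (z 1) (z (Suc k)) \<union> primes_between (z (Suc k)) (z (Suc (Suc k))). 1 / real p)"
    by (rule sum.union_disjoint[OF finite_primes_between finite_primes_between, symmetric])
       (auto simp: primes_between_def)
  also have "primes_between (z 1) (z (Suc k)) \<union> primes_between (z (Suc k)) (z (Suc (Suc k)))
       = primes_between (z 1) (z (Suc (Suc k)))"
    using z_mono[of 1 "Suc k"] z_mono[of "Suc k" "Suc (Suc k)"]
    by (auto simp: primes_between_def)
  finally show ?case by (simp add: z_def)
qed

section \<open>Counting by the large prime factor\<close>

definition bad_cofactor_primes :: "nat \<Rightarrow> nat set" where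
  "bad_cofactor_primes a = {p. prime p \<and> a < p \<and> int p dvd euler_num (a - 1)}"

text \<open>
  Since \<open>p\<close> exceeds the cofactor \<open>a\<close>, it divides \<open>p * a\<close> exactly once, and periodicity reduces the
  condition on the Euler number of index \<open>p * a - 1\<close> to the small index \<open>a - 1\<close>.
\<close>
lemma eisenstein_form_prime_times:
  assumes p: "prime p" "odd p" and a: "a \<ge> 2" "a < p" and nd: "p \<notin> bad_cofactor_primes a"
  shows "eisenstein_form (euler_poly (p * a) (p * a))"
proof (rule eisenstein_form_euler_poly[OF p])
  show "\<not> p\<^sup>2 dvd p * a"
    using p a by (auto simp: power2_eq_square dest: dvd_imp_le)
  show "\<not> int p dvd euler_num (p * a - 1)"
    using nd p a euler_num_kummer[OF p a(1)] by (simp add: bad_cofactor_primes_def)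
qed auto

text \<open>
  Numbers \<open>p * a\<close> with \<open>p > x\<close> and \<open>a\<close> even are counted through the pairs \<open>(p, a)\<close>. As
  \<open>a < t / x \<le> x < p\<close>, the pair is determined by the product. For each prime there are about
  \<open>t / (2 p)\<close> even cofactors, the rounding costs at most one per prime, hence \<open>y\<close> altogether. The
  pairs violating the condition on Euler numbers are counted the other way round, by cofactor:
  at most \<open>a\<close> primes for each \<open>a < t / x\<close>.
\<close>
lemma card_eisenstein_ge:
  fixes x y t :: real
  assumes x: "x \<ge> 2" "t \<le> x * x" and y: "y \<ge> 0"
  shows "real (card {n::nat. 1 \<le> n \<and> real n \<le> t \<and> eisenstein_form (euler_poly n n)}) \<ge>
           t / 2 * (\<Sum>p\<in>primes_between x y. 1 / real p) - y - (t / x)\<^sup>2"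
    (is "real (card ?N) \<ge> _")
proof (cases "t > 0")
  case False
  have "t / 2 * (\<Sum>p\<in>primes_between x y. 1 / real p) \<le> 0"
    using False by (intro mult_nonpos_nonneg sum_nonneg) auto
  thus ?thesis using y
    by (smt (verit) of_nat_0_le_iff zero_le_power2)
next
  case t: True
  define P where "P = primes_between x y"
  define E where "E p = {a::nat. even a \<and> a \<ge> 2 \<and> real (p * a) \<le> t}" for p
  define S where "S = (SIGMA p:P. E p)"
  define B where "B = {(p, a) \<in> S. p \<in> bad_cofactor_primes a}"
  have finP: "finite P" by (simp add: P_def)
  have P: "prime p" "real p > x" "p > 2" "odd p" if "p \<in> P" for p
  proof -
    show "prime p" "real p > x" using that by (auto simp: P_def primes_between_def)
    thus "p > 2" using x by linarith
    thus "odd p" using \<open>prime p\<close> prime_odd_nat by blast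
  qed
  have small: "real a < t / x" "a < p" if "p \<in> P" "a \<in> E p" for p a
  proof -
    have a: "real a > 0" "real p * real a \<le> t" using that by (auto simp: E_def)
    have "x * real a < real p * real a"
      using a P[OF that(1)] by (intro mult_strict_right_mono) auto
    hence "x * real a < t" using a by linarith
    thus 1: "real a < t / x" using x by (simp add: field_simps)
    also have "t / x \<le> x" using x by (simp add: field_simps)
    also have "x < real p" using P[OF that(1)] by simp
    finally show "a < p" by simp
  qed
  have finE: "finite (E p)" if "p \<in> P" for p
  proof (rule finite_subset)
    show "E p \<subseteq> {..<p}" using small(2)[OF that] by auto
  qed auto
  have finS: "finite S" unfolding S_def using finP finE by blast
  have BS: "B \<subseteq> S" by (auto simp: B_def)
  have finB: "finite B" using finite_subset[OF BS finS] .

  \<comment> \<open>A second large prime factor would have to divide the small cofactor.\<close>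
  have "inj_on (\<lambda>(p, a). p * a) S"
  proof (rule inj_onI, clarify)
    fix p a q b assume pa: "(p, a) \<in> S" and qb: "(q, b) \<in> S" and eq: "p * a = q * b"
    from pa qb have mem: "p \<in> P" "a \<in> E p" "q \<in> P" "b \<in> E q" by (auto simp: S_def)
    hence pos: "a > 0" "b > 0" by (auto simp: E_def)
    have "p = q"
    proof (rule ccontr)
      assume "p \<noteq> q"
      hence "p dvd b" "q dvd a"
        using eq P(1)[OF mem(1)] P(1)[OF mem(3)] primes_dvd_imp_eq
        by (metis dvd_triv_left prime_dvd_mult_iff)+
      hence "p \<le> b" "q \<le> a" using pos by (auto dest: dvd_imp_le)
      thus False using small(2)[OF mem(1,2)] small(2)[OF mem(3,4)] by simp
    qed
    thus "p = q \<and> a = b" using eq P(3)[OF mem(1)] by simp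
  qed
  hence inj: "inj_on (\<lambda>(p, a). p * a) (S - B)" by (rule inj_on_subset) auto
  have sub: "(\<lambda>(p, a). p * a) ` (S - B) \<subseteq> ?N"
  proof clarify
    fix p a assume pa: "(p, a) \<in> S" "(p, a) \<notin> B"
    hence mem: "p \<in> P" "a \<in> E p" "p \<notin> bad_cofactor_primes a" by (auto simp: S_def B_def)
    hence "a \<ge> 2" "real (p * a) \<le> t" by (auto simp: E_def)
    moreover have "1 \<le> p * a" using P(3)[OF mem(1)] \<open>a \<ge> 2\<close> by (simp add: Suc_le_eq)
    ultimately show "1 \<le> p * a \<and> real (p * a) \<le> t \<and> eisenstein_form (euler_poly (p * a) (p * a))"
      using eisenstein_form_prime_times[OF P(1,4)[OF mem(1)] _ small(2)[OF mem(1,2)] mem(3)] by blast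
  qed
  have finN: "finite ?N"
    by (rule finite_subset[of _ "{..nat \<lfloor>t\<rfloor>}"]) (auto simp: le_nat_floor)
  have "card (S - B) \<le> card ?N"
    using card_inj_on_le[OF inj sub finN] .
  moreover have "card (S - B) = card S - card B" by (rule card_Diff_subset[OF finB BS])
  ultimately have main: "real (card ?N) \<ge> real (card S) - real (card B)" by linarith

  have "t / 2 * (\<Sum>p\<in>P. 1 / real p) - y \<le> real (card S)"
  proof -
    have "t / (2 * real p) - 1 \<le> real (card (E p))" if "p \<in> P" for p
    proof -
      define m where "m = nat \<lfloor>t / (2 * real p)\<rfloor>"
      have p0: "real p > 0" using P(3)[OF that] by simp
      have m: "real m \<le> t / (2 * real p)" unfolding m_def using t p0 by simp
      have "(\<lambda>b. 2 * b) ` {1..m} \<subseteq> E p"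
      proof clarify
        fix b assume b: "b \<in> {1..m}"
        hence "real b \<le> t / (2 * real p)" using m by simp
        hence "real (p * (2 * b)) \<le> t" using p0 by (simp add: field_simps)
        thus "2 * b \<in> E p" using b by (simp add: E_def)
      qed
      hence "card ((\<lambda>b. 2 * b) ` {1..m}) \<le> card (E p)" by (rule card_mono[OF finE[OF that]])
      hence "m \<le> card (E p)" by (subst (asm) card_image) (auto simp: inj_on_def)
      moreover have "t / (2 * real p) - 1 \<le> real m" unfolding m_def using t p0 by linarith
      ultimately show ?thesis by linarith
    qed
    hence "(\<Sum>p\<in>P. t / (2 * real p) - 1) \<le> (\<Sum>p\<in>P. real (card (E p)))" by (rule sum_mono)
    also have "\<dots> = real (card S)" unfolding S_def using finP finE by (subst card_SigmaI) auto
    also have "(\<Sum>p\<in>P. t / (2 * real p) - 1) = t / 2 * (\<Sum>p\<in>P. 1 / real p) - real (card P)"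
      by (simp add: sum_subtractf sum_distrib_left)
    finally have "t / 2 * (\<Sum>p\<in>P. 1 / real p) - real (card P) \<le> real (card S)" .
    moreover have "card P \<le> nat \<lfloor>y\<rfloor>"
    proof -
      have "P \<subseteq> {1..nat \<lfloor>y\<rfloor>}"
        by (auto simp: P_def primes_between_def le_nat_floor Suc_le_eq dest: prime_gt_0_nat)
      from card_mono[OF _ this] show ?thesis by simp
    qed
    hence "real (card P) \<le> y" using y by linarith
    ultimately show ?thesis by linarith
  qed
  moreover have "real (card B) \<le> (t / x)\<^sup>2"
  proof -
    define K where "K = nat \<lfloor>t / x\<rfloor>"
    define A where "A = {a \<in> {1..K}. even a}"
    have A: "even a" "a \<ge> 2" "a \<le> K" if "a \<in> A" for a
      using that by (auto simp: A_def elim!: evenE)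
    have fin: "finite (bad_cofactor_primes a)" and card_le: "card (bad_cofactor_primes a) \<le> a" if "a \<in> A" for a
      unfolding bad_cofactor_primes_def
      using card_primes_gt_dvd_euler_num[OF A(1,2)[OF that]] by auto
    have finA: "finite A" by (simp add: A_def)
    have "prod.swap ` B \<subseteq> (SIGMA a:A. bad_cofactor_primes a)"
    proof
      fix z assume "z \<in> prod.swap ` B"
      then obtain p a where z: "z = (a, p)" "(p, a) \<in> B" by auto
      hence mem: "p \<in> P" "a \<in> E p" "p \<in> bad_cofactor_primes a" by (auto simp: B_def S_def)
      have "a \<le> K" unfolding K_def using small(1)[OF mem(1,2)] by (intro le_nat_floor) simp
      thus "z \<in> (SIGMA a:A. bad_cofactor_primes a)"
        using mem z by (auto simp: A_def E_def)
    qed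
    moreover have "finite (SIGMA a:A. bad_cofactor_primes a)" using finA fin by blast
    ultimately have "card (prod.swap ` B) \<le> card (SIGMA a:A. bad_cofactor_primes a)"
      by (intro card_mono)
    hence "card B \<le> card (SIGMA a:A. bad_cofactor_primes a)"
      by (subst (asm) card_image) auto
    also have "\<dots> = (\<Sum>a\<in>A. card (bad_cofactor_primes a))"
      using finA fin by (subst card_SigmaI) auto
    also have "\<dots> \<le> (\<Sum>a\<in>A. K)" using card_le A(3) by (intro sum_mono) (meson le_trans)
    also have "\<dots> \<le> (\<Sum>a\<in>{1..K}. K)" by (intro sum_mono2) (auto simp: A_def)
    also have "\<dots> = K\<^sup>2" by (simp add: power2_eq_square)
    finally have "real (card B) \<le> (real K)\<^sup>2"
      by (metis of_nat_le_iff of_nat_power)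
    also have "\<dots> \<le> (t / x)\<^sup>2"
      unfolding K_def using t x by (intro power_mono) auto
    finally show ?thesis .
  qed
  ultimately show ?thesis using main by (simp add: P_def)
qed

text \<open>
  With \<open>r = 2 powr (1 / N)\<close> the exponents \<open>r ^ i / 2\<close> subdivide the range from \<open>1 / 2\<close> to 1
  geometrically. Primes are taken between the exponents \<open>r / 2\<close> and \<open>1 / r\<close>: dropping the first
  interval makes the number of bad pairs, and dropping the last one makes the rounding error,
  smaller than \<open>t\<close> by a power of \<open>t\<close>. What remains tends to \<open>ln 2 / 2\<close> as \<open>N\<close> grows.
\<close>
lemma eventually_eisenstein_density_ge:
  assumes c: "c < ln 2 / 2"
  shows "eventually (\<lambda>t::real. c <
    real (card {n::nat. 1 \<le> n \<and> real n \<le> t \<and> eisenstein_form (euler_poly n n)}) / t) at_top"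
proof -
  have "(\<lambda>N::nat. (real N - 2) * (1 - 1 / 2 powr (1 / real N)) / 2) \<longlonglongrightarrow> ln 2 / 2"
    by real_asymp
  hence "eventually (\<lambda>N::nat. c < (real N - 2) * (1 - 1 / 2 powr (1 / real N)) / 2) sequentially"
    using c by (rule order_tendstoD)
  from eventually_happens[OF eventually_conj[OF this eventually_ge_at_top[of 2]]]
  obtain N :: nat where N: "N \<ge> 2" "c < (real N - 2) * (1 - 1 / 2 powr (1 / real N)) / 2"
    by auto
  define r :: real where "r = 2 powr (1 / real N)"
  define k where "k = N - 2"
  have r: "r > 1" unfolding r_def using N by (intro gr_one_powr) auto
  have rN: "r ^ N = 2" unfolding r_def using N by (simp add: powr_realpow[symmetric] powr_powr)
  have "r ^ N = r ^ Suc k * r" using N unfolding k_def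
    by (metis One_nat_def Suc_diff_le Suc_1 diff_Suc_Suc power_Suc2 Suc_diff_1 less_le_trans pos2)
  hence rk: "r ^ Suc k / 2 = 1 / r" using r rN by (simp add: field_simps)
  have c': "c < real k * (1 - 1 / r) / 2" using N by (simp add: k_def r_def of_nat_diff)
  define g where "g t = (1 / 2) * (real k * (1 - 1 / r - 12 / ln t)) - t powr (1 / r - 1) - t powr (1 - r)" for t
  have "((\<lambda>t. t powr (1 / r - 1)) \<longlongrightarrow> 0) at_top" "((\<lambda>t::real. t powr (1 - r)) \<longlongrightarrow> 0) at_top"
    using r by (intro tendsto_neg_powr filterlim_ident, simp)+
  moreover have "((\<lambda>t::real. 12 / ln t) \<longlongrightarrow> 0) at_top" by real_asymp
  ultimately have "(g \<longlongrightarrow> (1 / 2) * (real k * (1 - 1 / r - 0)) - 0 - 0) at_top"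
    unfolding g_def by (intro tendsto_intros)
  hence "eventually (\<lambda>t. c < g t) at_top"
    using c' by (intro order_tendstoD(1)) auto
  moreover have "eventually (\<lambda>t::real. t powr (r / 2) \<ge> 2) at_top"
  proof -
    have "filterlim (\<lambda>t::real. t powr (r / 2)) at_top at_top" using r by real_asymp
    thus ?thesis by (simp add: filterlim_at_top)
  qed
  ultimately show ?thesis using eventually_gt_at_top[of "1::real"]
  proof eventually_elim
    case (elim t)
    define x where "x = t powr (r / 2)"
    define y where "y = t powr (1 / r)"
    have xx: "x * x = t powr r" unfolding x_def by (simp flip: powr_add)
    have "t = t powr 1" using elim by simp
    also have "\<dots> \<le> t powr r" using elim r by (intro powr_mono) auto
    finally have tx: "t \<le> x * x" using xx by simp
    have sum: "real k * (1 - 1 / r - 12 / ln t) \<le> (\<Sum>p\<in>primes_between x y. 1 / real p)"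
      using sum_inverse_primes_geometric[of r t k] r elim unfolding rk x_def y_def by simp
    have "t * g t = t / 2 * (real k * (1 - 1 / r - 12 / ln t)) - t * t powr (1 / r - 1) - t * t powr (1 - r)"
      unfolding g_def by (simp add: algebra_simps)
    also have "t * t powr (1 / r - 1) = y"
      using elim by (simp add: y_def powr_mult_base)
    also have "t * t powr (1 - r) = (t / x)\<^sup>2"
    proof -
      have "(t / x)\<^sup>2 = t * t / t powr r" by (simp add: power2_eq_square xx flip: xx)
      also have "\<dots> = t * t powr (1 - r)" using elim by (simp add: powr_diff)
      finally show ?thesis ..
    qed
    also have "t / 2 * (real k * (1 - 1 / r - 12 / ln t)) \<le> t / 2 * (\<Sum>p\<in>primes_between x y. 1 / real p)"
      using sum elim by (intro mult_left_mono) auto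
    also have "t / 2 * (\<Sum>p\<in>primes_between x y. 1 / real p) - y - (t / x)\<^sup>2
       \<le> real (card {n::nat. 1 \<le> n \<and> real n \<le> t \<and> eisenstein_form (euler_poly n n)})"
      using elim tx by (intro card_eisenstein_ge) (auto simp: x_def y_def)
    finally have "g t \<le> real (card {n::nat. 1 \<le> n \<and> real n \<le> t \<and> eisenstein_form (euler_poly n n)}) / t"
      using elim by (simp add: field_simps)
    thus ?case using elim by linarith
  qed
qed

text \<open>
  Five terms of the series are needed: with four, the lower bound falls short.
\<close>
lemma ln_2_bounds: "0.69314 < ln (2::real)" "ln (2::real) < 0.69316"
  using ln_approx_bounds[of 2 5] by (simp_all add: eval_nat_numeral)

theorem theorem2:
  shows "Liminf at_top (\<lambda>t::real.
             ereal (real (card {n::nat. 1 \<le> n \<and> real n \<le> t \<and> eisenstein_form (euler_poly n n)}) / t))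
           \<ge> ereal (ln 2 / 2)
         \<and> 0.34657 \<le> ln 2 / (2::real) \<and> ln 2 / (2::real) < 0.34658
         \<and> lower_density {n. 1 \<le> n \<and> irreducible (euler_poly n n) \<and> eisenstein (euler_poly n n)}
           > ereal (1 / 3)"
proof (intro conjI)
  show liminf: "Liminf at_top (\<lambda>t::real.
             ereal (real (card {n::nat. 1 \<le> n \<and> real n \<le> t \<and> eisenstein_form (euler_poly n n)}) / t))
           \<ge> ereal (ln 2 / 2)" (is "Liminf _ ?d \<ge> _")
    unfolding le_Liminf_iff
  proof (intro allI impI)
    fix c :: ereal assume c: "c < ereal (ln 2 / 2)"
    show "eventually (\<lambda>t. c < ?d t) at_top"
    proof (cases c)
      case (real c')
      thus ?thesis using c eventually_eisenstein_density_ge[of c'] by simp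
    qed (use c in auto)
  qed
  show bounds: "0.34657 \<le> ln 2 / (2::real)" "ln 2 / (2::real) < 0.34658"
    using ln_2_bounds by simp_all
  have "ereal (1 / 3) < ereal (ln 2 / 2)" using bounds by simp
  also have "\<dots> \<le> Liminf at_top ?d" by (rule liminf)
  also have "\<dots> \<le> lower_density {n. 1 \<le> n \<and> irreducible (euler_poly n n) \<and> eisenstein (euler_poly n n)}"
    unfolding lower_density_def
  proof (rule Liminf_mono)
    show "eventually (\<lambda>t. ?d t \<le> ereal (real (card {n \<in> {n. 1 \<le> n \<and> irreducible (euler_poly n n)
        \<and> eisenstein (euler_poly n n)}. 1 \<le> n \<and> real n \<le> t}) / t)) at_top"
      using eventually_gt_at_top[of "0::real"]
    proof eventually_elim
      case (elim t)
      have "card {n::nat. 1 \<le> n \<and> real n \<le> t \<and> eisenstein_form (euler_poly n n)}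
        \<le> card {n \<in> {n. 1 \<le> n \<and> irreducible (euler_poly n n)
                    \<and> eisenstein (euler_poly n n)}. 1 \<le> n \<and> real n \<le> t}"
      proof (rule card_mono)
        show "finite {n \<in> {n. 1 \<le> n \<and> irreducible (euler_poly n n)
                    \<and> eisenstein (euler_poly n n)}. 1 \<le> n \<and> real n \<le> t}"
          by (rule finite_subset[of _ "{..nat \<lfloor>t\<rfloor>}"]) (auto simp: le_nat_floor)
      qed (auto intro: eisenstein_form_imp_irreducible eisenstein_form_imp_eisenstein)
      thus ?case using elim by (simp add: divide_right_mono)
    qed
  qed
  finally show "lower_density {n. 1 \<le> n \<and> irreducible (euler_poly n n) \<and> eisenstein (euler_poly n n)}
           > ereal (1 / 3)" .
qed

end
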